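(* Let $G$ be a distribution function on $\mathbb{R}$, $\overline{G}=1-G$, and suppose there exist $a>0$ and $M_0>0$ such that $$\overline{G}(x+M)\le e^{-aM}\,\overline{G}(x)\qquad\text{for all }x\ge 0,\ M\ge M_0 .$$ Let $\{p_k\}_{k\ge 1}$ be a probability distribution on $\{1,2,\dots\}$ with $p_1<1$ and $$\sum_{k=1}^\infty k^\theta p_k<\infty\qquad\text{for some }\theta\in(1,2].$$ Consider the branching random walk with random walk increment distribution $G$ and branching law $\{p_k\}_{k\ge1}$, and let $\mathcal{M}_n$ be its maximal displacement at time $n$. Then the sequence of random variables $\{\mathcal{M}_n^s\}_{n\ge 0}$, where $\mathcal{M}_n^s=\mathcal{M}_n-\mathrm{Med}(F_n)$ and $F_n$ is the distribution function of $\mathcal{M}_n$, is tight.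
   Context: Branching random walk (BRW): one particle starts at $0\in\mathbb{R}$ at time $0$. Over one time step a particle moves by a random displacement with distribution function $G$; it then dies and gives birth, at its new position, to $k$ offspring with probability $p_k$, independently of the displacement (here $p_0=0$). Each offspring then independently repeats the same procedure over the next time step; all displacements and all offspring numbers are independent. Let $Z_n$ be the number of particles at time $n$ and $\mathfrak{x}_1(n),\dots,\mathfrak{x}_{Z_n}(n)$ their positions. The maximal displacement is $\mathcal{M}_n=\max_{1\le k\le Z_n}\mathfrak{x}_k(n)$. Equivalently, $\overline F_n=1-F_n$ satisfies $\overline F_0(x)=\mathbf 1_{\{x<0\}}$ and $\overline F_{n+1}(x)=-\int_{\mathbb{R}}\overline G(x-y)\,dQ(\overline F_n(y))$ with $Q(u)=1-\sum_k p_k(1-u)^k$. Median: $\mathrm{Med}(F)=\inf\{x: F(x)\ge 1/2\}$. Tightness: with $F_n^s$ the distribution function of $\mathcal{M}_n^s$, for every $\varepsilon>0$ there is $A_\varepsilon>0$ with $F_n^s(A_\varepsilon)-F_n^s(-A_\varepsilon)>1-\varepsilon$ for all $n$. *)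

theory Defs
  imports "HOL-Probability.Probability"
begin

definition distribution_function :: "(real \<Rightarrow> real) \<Rightarrow> bool" where
  "distribution_function F \<longleftrightarrow>
     mono F \<and> (\<forall>x. continuous (at_right x) F) \<and>
     (F \<longlongrightarrow> 0) at_bot \<and> (F \<longlongrightarrow> 1) at_top"

definition median :: "(real \<Rightarrow> real) \<Rightarrow> real" where
  "median F = Inf {x. F x \<ge> 1 / 2}"

text \<open>
  Particles carry Ulam--Harris labels: the initial particle is \<open>[]\<close> and \<open>u @ [i]\<close> is the
  \<open>i\<close>-th child (counting from 0) of \<open>u\<close>, so a particle present at time \<open>n\<close> has a label of
  length \<open>n\<close>. \<open>X u\<close> and \<open>N u\<close> are the displacement and the offspring number of the particle
  labelled \<open>u\<close>; the labels that are never born have variables too, which are simply not used.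
\<close>

locale branching_random_walk = prob_space \<Omega>
  for \<Omega> :: "'a measure" and G :: "real \<Rightarrow> real" and p :: "nat pmf"
    and X :: "nat list \<Rightarrow> 'a \<Rightarrow> real" and N :: "nat list \<Rightarrow> 'a \<Rightarrow> nat" +
  assumes X_measurable: "X u \<in> borel_measurable \<Omega>"
    and N_measurable: "N u \<in> measurable \<Omega> (count_space UNIV)"
    and X_distribution: "cdf (distr \<Omega> borel (X u)) = G"
    and N_distribution: "distr \<Omega> (count_space UNIV) (N u) = measure_pmf p"
    \<comment> \<open>offspring numbers are cast to \<open>real\<close> so that all variables form one family\<close>
    and independent: "indep_vars (\<lambda>_. borel) (case_sum X (\<lambda>u \<omega>. real (N u \<omega>))) UNIV"

primrec particles :: "(nat list \<Rightarrow> 'a \<Rightarrow> nat) \<Rightarrow> nat \<Rightarrow> 'a \<Rightarrow> nat list set" where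
  "particles N 0 \<omega> = {[]}"
| "particles N (Suc n) \<omega> = (\<Union>u\<in>particles N n \<omega>. (\<lambda>i. u @ [i]) ` {..<N u \<omega>})"

text \<open>
  A particle moves first and branches at its new position, so children are born at the position
  of the parent plus the displacement of the parent; \<open>u\<close> itself has not yet moved by \<open>X u\<close>
  at time \<open>length u\<close>.
\<close>

definition position :: "(nat list \<Rightarrow> 'a \<Rightarrow> real) \<Rightarrow> nat list \<Rightarrow> 'a \<Rightarrow> real" where
  "position X u \<omega> = (\<Sum>k<length u. X (take k u) \<omega>)"

lemma position_Nil: "position X [] \<omega> = 0"
  by (simp add: position_def)

lemma position_child: "position X (u @ [i]) \<omega> = position X u \<omega> + X u \<omega>"
  by (simp add: position_def)

definition max_displacement ::
  "(nat list \<Rightarrow> 'a \<Rightarrow> real) \<Rightarrow> (nat list \<Rightarrow> 'a \<Rightarrow> nat) \<Rightarrow> nat \<Rightarrow> 'a \<Rightarrow> real" where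
  "max_displacement X N n \<omega> = Max ((\<lambda>u. position X u \<omega>) ` particles N n \<omega>)"

lemma finite_particles: "finite (particles N n \<omega>)"
  by (induction n) auto

text \<open>The library notion \<^const>\<open>tight\<close> in terms of distribution functions and symmetric intervals:\<close>

lemma tight_iff_cdf:
  "tight \<mu> \<longleftrightarrow> (\<forall>n. real_distribution (\<mu> n)) \<and>
     (\<forall>\<epsilon>>0. \<exists>A>0. \<forall>n. cdf (\<mu> n) A - cdf (\<mu> n) (- A) > 1 - \<epsilon>)"
proof (cases "\<forall>n. real_distribution (\<mu> n)")
  case True
  have *: "measure (\<mu> n) {a<..b} = cdf (\<mu> n) b - cdf (\<mu> n) a" if "a < b" for n a b
  proof -
    interpret real_distribution "\<mu> n" using True by blast
    show ?thesis using cdf_diff_eq[OF that] by simp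
  qed
  have mono: "cdf (\<mu> n) a \<le> cdf (\<mu> n) b" if "a \<le> b" for n a b
  proof -
    interpret real_distribution "\<mu> n" using True by blast
    show ?thesis using cdf_nondecreasing[OF that] .
  qed
  show ?thesis
  proof
    assume t: "tight \<mu>"
    have "\<exists>A>0. \<forall>n. cdf (\<mu> n) A - cdf (\<mu> n) (- A) > 1 - \<epsilon>" if "\<epsilon> > 0" for \<epsilon>
    proof -
      obtain a b where ab: "a < b" "\<forall>n. measure (\<mu> n) {a<..b} > 1 - \<epsilon>"
        using t \<open>\<epsilon> > 0\<close> unfolding tight_def by blast
      define A where "A = max 1 (max \<bar>a\<bar> \<bar>b\<bar>)"
      have A: "A > 0" "b \<le> A" "- A \<le> a" by (auto simp: A_def)
      have "cdf (\<mu> n) A - cdf (\<mu> n) (- A) > 1 - \<epsilon>" for n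
        using ab *[OF ab(1), of n] mono[OF A(2), of n] mono[OF A(3), of n]
        by (smt (verit))
      with A(1) show ?thesis by blast
    qed
    with True show "(\<forall>n. real_distribution (\<mu> n)) \<and>
      (\<forall>\<epsilon>>0. \<exists>A>0. \<forall>n. cdf (\<mu> n) A - cdf (\<mu> n) (- A) > 1 - \<epsilon>)" by blast
  next
    assume r: "(\<forall>n. real_distribution (\<mu> n)) \<and>
      (\<forall>\<epsilon>>0. \<exists>A>0. \<forall>n. cdf (\<mu> n) A - cdf (\<mu> n) (- A) > 1 - \<epsilon>)"
    have "\<exists>a b. a < b \<and> (\<forall>n. measure (\<mu> n) {a<..b} > 1 - \<epsilon>)" if "\<epsilon> > 0" for \<epsilon>
    proof -
      obtain A where A: "A > 0" "\<forall>n. cdf (\<mu> n) A - cdf (\<mu> n) (- A) > 1 - \<epsilon>"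
        using r \<open>\<epsilon> > 0\<close> by blast
      then have "- A < A" by simp
      with A *[OF this] show ?thesis by (metis (no_types))
    qed
    with True show "tight \<mu>" unfolding tight_def by blast
  qed
qed (auto simp: tight_def)

end

theory Submission imports Defs begin

text \<open>
  Let \<open>u\<^sub>n(x)\<close> be the probability that the maximal displacement at time \<open>n\<close> exceeds \<open>x\<close>.
  Conditioning on the first step gives \<open>u\<^sub>n\<^sub>+\<^sub>1(x) = E Q(u\<^sub>n(x - X))\<close>, where \<open>X\<close> is a displacement and
  \<open>Q(s) = E (1 - (1 - s) ^ N)\<close> for an offspring number \<open>N\<close>
  (\<open>prob_max_displacement_le\<close>). Tightness around the median says that a point where
  \<open>u\<^sub>n \<ge> \<delta>\<close> lies at most a bounded distance to the right of any point where \<open>u\<^sub>n \<le> 1 - \<eta>\<close>, with a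
  bound that does not depend on \<open>n\<close> (\<open>bounded_width\<close>). The left tail of \<open>X\<close> may be so heavy that
  the maximal displacement has no expectation, so the recursion is studied directly.

  The main point is that the right tail of \<open>u\<^sub>n\<close> decays geometrically, uniformly in \<open>n\<close>. This follows
  from an inequality that the recursion preserves (\<open>uniform_ratio\<close>): for suitable \<open>S\<close>,
  \<open>\<epsilon>\<close> and \<open>C\<close>,
  \<open>u\<^sub>n(x - S) \<ge> (1 + \<epsilon> - min \<epsilon> (C u\<^sub>n(x)\<^sup>\<kappa>)) u\<^sub>n(x)\<close>,
  where \<open>1 + \<kappa>\<close> moments of \<open>N\<close> are finite. One step of the recursion consists of two operations. The
  map \<open>Q\<close> is nearly multiplication by the mean of \<open>N\<close> for small arguments, and as the mean is greater
  than \<open>1\<close>, the error term \<open>C u\<^sub>n(x)\<^sup>\<kappa>\<close> becomes smaller in relation to the new values, by a definite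
  factor (\<open>offspring_step\<close>). Averaging over \<open>X\<close> may spoil the inequality where the values
  averaged are much larger than their mean. But either \<open>u\<^sub>n\<close> already grows enough within a bounded
  distance, or such values require large \<open>X\<close>, and there the assumption on \<open>G\<close> itself makes the
  tail grow by a large factor under a shift (\<open>shift_gain\<close>); the definite factor gained before leaves room to combine the two
  effects (\<open>convolution_step\<close>).

  The levels between \<open>\<delta>\<^sub>0\<close> and \<open>1 - \<eta>\<close>, for which the inequality says nothing, are treated by going
  backward in time. As \<open>Q(s) > s\<close> on the open unit interval, a level \<open>1 - \<eta>\<close> falls below \<open>\<delta>\<^sub>0\<close> within
  a bounded number of steps back (\<open>back_low\<close>), while a level \<open>\<delta>\<close> stays bounded away from
  \<open>0\<close> (\<open>back_high\<close>); the points move by bounded distances. At the earlier time the decay of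
  the right tail applies.
\<close>

section \<open>The offspring map\<close>

text \<open>
  If each of \<open>k\<close> independent subtrees exceeds a level with probability \<open>s\<close>, then \<open>1 - (1 - s) ^ k\<close>
  is the probability that one of them does. Averaging over the offspring number gives the
  nonlinearity of the recursion, commonly written \<open>Q(s)\<close>.
\<close>

definition offspring_map :: "nat pmf \<Rightarrow> real \<Rightarrow> real" where
  "offspring_map p s = measure_pmf.expectation p (\<lambda>k. 1 - (1 - s) ^ k)"

lemma integrable_offspring:
  fixes s :: real
  assumes "0 \<le> s" "s \<le> 1"
  shows "integrable (measure_pmf p) (\<lambda>k. 1 - (1 - s) ^ k)"
proof (rule measure_pmf.integrable_const_bound[where B = 1])
  have "0 \<le> (1 - s) ^ k \<and> (1 - s) ^ k \<le> 1" for k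
    using assms by (simp add: power_le_one)
  then show "AE k in measure_pmf p. norm (1 - (1 - s) ^ k) \<le> 1" by simp
qed simp

lemma offspring_map_mono:
  assumes "0 \<le> s" "s \<le> t" "t \<le> 1"
  shows "offspring_map p s \<le> offspring_map p t"
  unfolding offspring_map_def
  by (rule integral_mono) (use assms in \<open>auto intro!: integrable_offspring power_mono\<close>)

lemma offspring_map_bounds:
  assumes "0 \<le> s" "s \<le> 1"
  shows "0 \<le> offspring_map p s" "offspring_map p s \<le> 1"
proof -
  have b: "0 \<le> (1 - s) ^ k \<and> (1 - s) ^ k \<le> 1" for k
    using assms by (simp add: power_le_one)
  show "0 \<le> offspring_map p s"
    unfolding offspring_map_def by (rule Bochner_Integration.integral_nonneg) (use b in auto)
  show "offspring_map p s \<le> 1"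
    unfolding offspring_map_def
    by (rule measure_pmf.integral_le_const) (use b integrable_offspring[OF assms] in auto)
qed

lemma prob_pmf_not_singleton:
  "measure_pmf.prob p (- {a}) = 1 - pmf p a"
  using measure_pmf.prob_compl[of "{a}" p]
  by (simp add: Compl_eq_Diff_UNIV measure_pmf_single)

lemma integrable_indicator_pmf: "integrable (measure_pmf p) (indicator A :: 'b \<Rightarrow> real)"
  by (simp add: less_top[symmetric])

text \<open>
  A particle with at least two children beats a single child: \<open>(1 - s) ^ k \<le> (1 - s)\<^sup>2\<close> for
  \<open>k \<ge> 2\<close>. The strict gain away from \<open>0\<close> and \<open>1\<close> drives the backward argument below.
\<close>

lemma offspring_map_gain:
  assumes s: "0 \<le> s" "s \<le> 1" and p: "set_pmf p \<subseteq> {1..}"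
  shows "s + (1 - pmf p 1) * (s * (1 - s)) \<le> offspring_map p s"
proof -
  have pt: "s + s * (1 - s) * indicator (- {1}) k \<le> 1 - (1 - s) ^ k" if "k \<in> set_pmf p" for k
  proof -
    have "k \<ge> 1" using p that by auto
    show ?thesis
    proof (cases "k = 1")
      case False
      then have "k \<ge> 2" using \<open>k \<ge> 1\<close> by simp
      then have "(1 - s) ^ k \<le> (1 - s) ^ 2"
        using s by (intro power_decreasing) auto
      then show ?thesis using False by (simp add: power2_eq_square algebra_simps)
    qed simp
  qed
  have "s + (1 - pmf p 1) * (s * (1 - s)) =
      measure_pmf.expectation p (\<lambda>k. s + s * (1 - s) * indicator (- {1}) k)"
    using integrable_indicator_pmf[of p "- {1}"]
    by (simp add: prob_pmf_not_singleton algebra_simps del: One_nat_def)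
  also have "\<dots> \<le> offspring_map p s"
    unfolding offspring_map_def
    by (rule integral_mono_AE)
       (use pt s in \<open>auto simp: AE_measure_pmf_iff integrable_indicator_pmf intro!: integrable_offspring\<close>)
  finally show ?thesis .
qed

text \<open>
  The second bound interpolates between the trivial estimate \<open>z\<close> and the quadratic Taylor
  estimate \<open>z\<^sup>2\<close>, where \<open>z = k s\<close>. It costs only \<open>1 + \<kappa>\<close> moments of the offspring number.
\<close>

lemma one_minus_power_bounds:
  fixes s \<kappa> :: real
  assumes s: "0 \<le> s" "s \<le> 1" and \<kappa>: "0 < \<kappa>" "\<kappa> \<le> 1"
  shows "1 - (1 - s) ^ k \<le> real k * s"
    and "real k * s - (1 - (1 - s) ^ k) \<le> real k powr (1 + \<kappa>) * s powr (1 + \<kappa>)"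
proof -
  have bern: "1 - real j * s \<le> (1 - s) ^ j" for j
    using Bernoulli_inequality[of "- s" j] s by (simp add: algebra_simps)
  show first: "1 - (1 - s) ^ k \<le> real k * s" using bern[of k] by simp
  \<comment> \<open>The second order term of the binomial expansion, by induction on the number of children.\<close>
  have q: "real k * s - (1 - (1 - s) ^ k) \<le> (real k * s)\<^sup>2"
  proof (induction k)
    case (Suc k)
    have "(1 - s) ^ Suc k = (1 - s) ^ k - s * (1 - s) ^ k" by (simp add: algebra_simps)
    moreover have "s * (1 - (1 - s) ^ k) \<le> s * (real k * s)"
      using bern[of k] s by (intro mult_left_mono) auto
    ultimately have "real (Suc k) * s - (1 - (1 - s) ^ Suc k) \<le> (real k * s)\<^sup>2 + s * (real k * s)"
      using Suc by (simp add: algebra_simps)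
    also have "\<dots> \<le> (real (Suc k) * s)\<^sup>2"
      using s by (simp add: power2_eq_square algebra_simps)
    finally show ?case .
  qed simp
  have pw: "(1 - s) ^ k \<le> 1" using s by (simp add: power_le_one)
  define z where "z = real k * s"
  have z: "0 \<le> z" using s by (simp add: z_def)
  have "z - (1 - (1 - s) ^ k) \<le> z powr (1 + \<kappa>)"
  proof (cases "z \<le> 1")
    case True
    have "z\<^sup>2 \<le> z powr (1 + \<kappa>)"
    proof (cases "z = 0")
      case False
      then have "z powr 2 \<le> z powr (1 + \<kappa>)" using True z \<kappa> by (intro powr_mono') auto
      then show ?thesis using False z by simp
    qed simp
    then show ?thesis using q by (simp add: z_def)
  next
    case False
    then have "z powr 1 \<le> z powr (1 + \<kappa>)" using \<kappa> by (intro powr_mono) auto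
    then show ?thesis using pw False by simp
  qed
  then show "real k * s - (1 - (1 - s) ^ k) \<le> real k powr (1 + \<kappa>) * s powr (1 + \<kappa>)"
    using s by (simp add: z_def powr_mult)
qed

text \<open>
  Near \<open>0\<close> the offspring map is multiplication by the mean, up to an error of order
  \<open>s powr (1 + \<kappa>)\<close>. This is where the moment assumption on the offspring law enters.
\<close>

lemma offspring_map_linear:
  fixes p :: "nat pmf"
  assumes s: "0 \<le> s" "s \<le> 1" and \<kappa>: "0 < \<kappa>" "\<kappa> \<le> 1"
    and int: "integrable (measure_pmf p) (\<lambda>k. real k powr (1 + \<kappa>))"
    and int1: "integrable (measure_pmf p) real"
  shows "offspring_map p s \<le> measure_pmf.expectation p real * s"
    and "measure_pmf.expectation p real * s -
      measure_pmf.expectation p (\<lambda>k. real k powr (1 + \<kappa>)) * s powr (1 + \<kappa>) \<le> offspring_map p s"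
proof -
  have "offspring_map p s \<le> measure_pmf.expectation p (\<lambda>k. real k * s)"
    unfolding offspring_map_def
    by (rule integral_mono[OF integrable_offspring[OF s]])
       (use int1 one_minus_power_bounds(1)[OF s \<kappa>] in auto)
  then show "offspring_map p s \<le> measure_pmf.expectation p real * s" by simp
  have "measure_pmf.expectation p (\<lambda>k. real k * s - real k powr (1 + \<kappa>) * s powr (1 + \<kappa>)) \<le> offspring_map p s"
    unfolding offspring_map_def
  proof (rule integral_mono[OF _ integrable_offspring[OF s]])
    show "real k * s - real k powr (1 + \<kappa>) * s powr (1 + \<kappa>) \<le> 1 - (1 - s) ^ k" for k
      using one_minus_power_bounds(2)[OF s \<kappa>, of k] by linarith
  qed (use int int1 in auto)
  also have "measure_pmf.expectation p (\<lambda>k. real k * s - real k powr (1 + \<kappa>) * s powr (1 + \<kappa>)) =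
    measure_pmf.expectation p real * s -
      measure_pmf.expectation p (\<lambda>k. real k powr (1 + \<kappa>)) * s powr (1 + \<kappa>)"
    using int int1 by simp
  finally show "measure_pmf.expectation p real * s -
      measure_pmf.expectation p (\<lambda>k. real k powr (1 + \<kappa>)) * s powr (1 + \<kappa>) \<le> offspring_map p s" .
qed

lemma integrable_real_if_integrable_powr:
  fixes p :: "nat pmf"
  assumes "0 < \<kappa>" "integrable (measure_pmf p) (\<lambda>k. real k powr (1 + \<kappa>))"
  shows "integrable (measure_pmf p) real"
proof (rule Bochner_Integration.integrable_bound[OF assms(2)])
  have "real k \<le> real k powr (1 + \<kappa>)" for k
    using powr_mono[of 1 "1 + \<kappa>" "real k"] assms(1) by (cases "k = 0") auto
  then show "AE k in measure_pmf p. norm (real k) \<le> norm (real k powr (1 + \<kappa>))" by simp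
qed simp

lemma integrable_measure_pmf_if_summable:
  fixes p :: "nat pmf" and f :: "nat \<Rightarrow> real"
  assumes "summable (\<lambda>k. f k * pmf p k)" "\<And>k. 0 \<le> f k"
  shows "integrable (measure_pmf p) f"
proof -
  have "integrable (count_space UNIV) (\<lambda>k. pmf p k *\<^sub>R f k)"
    using assms by (simp add: integrable_count_space_nat_iff mult.commute abs_mult)
  then show ?thesis
    by (subst measure_pmf_eq_density, subst integrable_density) auto
qed

lemma offspring_mean_gt_1:
  fixes p :: "nat pmf"
  assumes p: "set_pmf p \<subseteq> {1..}" and p1: "pmf p 1 < 1" and int: "integrable (measure_pmf p) real"
  shows "1 < measure_pmf.expectation p real"
proof -
  have "1 + (1 - pmf p 1) = measure_pmf.expectation p (\<lambda>k. 1 + indicator (- {1}) k)"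
    using integrable_indicator_pmf[of p "- {1}"]
    by (simp add: prob_pmf_not_singleton del: One_nat_def)
  also have "\<dots> \<le> measure_pmf.expectation p real"
  proof (rule integral_mono_AE)
    have "1 + indicator (- {1}) k \<le> real k" if "k \<in> set_pmf p" for k
      using that p by (cases "k \<le> 1") (auto simp: indicator_def)
    then show "AE k in measure_pmf p. 1 + indicator (- {1}) k \<le> real k"
      by (simp add: AE_measure_pmf_iff)
  qed (auto simp: int integrable_indicator_pmf)
  finally show ?thesis using p1 by simp
qed

section \<open>Growth under the offspring map\<close>

text \<open>
  The slack is the amount by which the ratio of the tail at two points a fixed distance apart is
  allowed to fall short of \<open>1 + \<epsilon>\<close>, as a function of the value \<open>s\<close> of the tail. It vanishes like a
  power at \<open>s = 0\<close>. It is capped at \<open>\<epsilon>\<close> because the ratio of a decreasing function is always at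
  least \<open>1\<close>; so the condition is vacuous unless the tail is small.
\<close>

definition slack :: "real \<Rightarrow> real \<Rightarrow> real \<Rightarrow> real \<Rightarrow> real" where
  "slack \<epsilon> C \<kappa> s = min \<epsilon> (C * s powr \<kappa>)"

lemma slack_le: "slack \<epsilon> C \<kappa> s \<le> \<epsilon>"
  by (simp add: slack_def)

lemma slack_nonneg: "0 \<le> \<epsilon> \<Longrightarrow> 0 \<le> C \<Longrightarrow> 0 \<le> slack \<epsilon> C \<kappa> s"
  by (simp add: slack_def)

lemma slack_mono: "0 \<le> C \<Longrightarrow> 0 \<le> \<kappa> \<Longrightarrow> 0 \<le> s \<Longrightarrow> s \<le> t \<Longrightarrow> slack \<epsilon> C \<kappa> s \<le> slack \<epsilon> C \<kappa> t"
  unfolding slack_def by (intro min.mono mult_left_mono powr_mono2) auto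

lemma powr_scale_le:
  fixes l s \<kappa> :: real
  assumes "1 \<le> l" "0 \<le> s" "0 < \<kappa>" "\<kappa> \<le> 1"
  shows "(l * s) powr \<kappa> \<le> l * s powr \<kappa>"
proof -
  have "l powr \<kappa> \<le> l powr 1" using assms by (intro powr_mono) auto
  then show ?thesis using assms by (simp add: powr_mult mult_right_mono)
qed

lemma slack_scale_le:
  assumes "1 \<le> l" "0 \<le> s" "0 < \<kappa>" "\<kappa> \<le> 1" "0 \<le> C" "0 \<le> \<epsilon>"
  shows "slack \<epsilon> C \<kappa> (l * s) \<le> l * slack \<epsilon> C \<kappa> s"
proof -
  have "C * (l * s) powr \<kappa> \<le> C * (l * s powr \<kappa>)"
    using assms by (intro mult_left_mono powr_scale_le)
  moreover have "\<epsilon> \<le> l * \<epsilon>" using assms by (simp add: mult_le_cancel_right1)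
  ultimately show ?thesis
    using assms unfolding slack_def min_mult_distrib_left by (auto simp: min_def algebra_simps)
qed

text \<open>
  The offspring map loses some of the ratio, since it is concave, but the loss is of order
  \<open>u powr \<kappa>\<close>. In exchange it multiplies small values by almost the mean, which is larger than
  \<open>B\<close>, so that measuring the slack at \<open>Q(u) / B\<close> instead of at \<open>u\<close> enlarges it by a factor larger
  than \<open>1\<close>. If \<open>C\<close> is large, this gain is larger than the loss.
\<close>

lemma offspring_step:
  fixes p :: "nat pmf"
  assumes p: "set_pmf p \<subseteq> {1..}" "pmf p 1 < 1"
    and \<kappa>: "0 < \<kappa>" "\<kappa> \<le> 1"
    and int: "integrable (measure_pmf p) (\<lambda>k. real k powr (1 + \<kappa>))"
    and \<epsilon>: "0 < \<epsilon>" "\<epsilon> \<le> 1"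
    and B: "1 < B" "B < measure_pmf.expectation p real"
  obtains C where "\<epsilon> \<le> C"
    "\<And>u r. \<lbrakk>0 \<le> u; r \<le> 1; (1 + \<epsilon> - slack \<epsilon> C \<kappa> u) * u \<le> r\<rbrakk> \<Longrightarrow>
      (1 + \<epsilon> - slack \<epsilon> C \<kappa> (offspring_map p u / B)) * offspring_map p u \<le> offspring_map p r"
proof -
  define m where "m = measure_pmf.expectation p real"
  define K where "K = measure_pmf.expectation p (\<lambda>k. real k powr (1 + \<kappa>))"
  \<comment> \<open>Small values are multiplied by at least \<open>m'\<close>, and \<open>\<eta>\<close> is the relative gain in slack.\<close>
  define m' where "m' = (B + m) / 2"
  define \<eta> where "\<eta> = (m' / B) powr \<kappa> - 1"
  have int1: "integrable (measure_pmf p) real"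
    by (rule integrable_real_if_integrable_powr[OF \<kappa>(1) int])
  have K: "0 \<le> K" unfolding K_def by (rule Bochner_Integration.integral_nonneg) simp
  have m': "B < m'" "m' < m" using B by (auto simp: m'_def m_def)
  have \<eta>: "0 < \<eta>"
    using gr_one_powr[of "m' / B" \<kappa>] m' B \<kappa> by (simp add: \<eta>_def)
  define C where "C = max \<epsilon> (max (4 * K / \<eta>) (\<epsilon> * B powr \<kappa> * K / (m - m')))"
  have C1: "\<epsilon> \<le> C" and C2: "4 * K \<le> C * \<eta>" and C3: "\<epsilon> * B powr \<kappa> * K \<le> C * (m - m')"
    using \<eta> m' by (auto simp: C_def pos_divide_le_eq[symmetric])
  have C0: "0 < C" using C1 \<epsilon> by linarith
  let ?Q = "offspring_map p"
  have "(1 + \<epsilon> - slack \<epsilon> C \<kappa> (?Q u / B)) * ?Q u \<le> ?Q r"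
    if u: "0 \<le> u" and r1: "r \<le> 1" and ur: "(1 + \<epsilon> - slack \<epsilon> C \<kappa> u) * u \<le> r" for u r
  proof -
    define e where "e = 1 + \<epsilon> - slack \<epsilon> C \<kappa> u"
    have e: "1 \<le> e" "e \<le> 2"
      using slack_le[of \<epsilon> C \<kappa> u] slack_nonneg[of \<epsilon> C \<kappa> u] \<epsilon> C0 by (auto simp: e_def)
    define t where "t = e * u"
    have t: "u \<le> t" "t \<le> 2 * u" "t \<le> r"
      using e u ur by (auto simp: t_def e_def[symmetric] mult_le_cancel_right1 mult_right_mono)
    have u1: "u \<le> 1" using t r1 by linarith
    have Qu: "u \<le> ?Q u"
      using offspring_map_gain[OF u u1 p(1)] u u1 p(2) by (smt (verit) mult_nonneg_nonneg)
    have Qr: "?Q t \<le> ?Q r" and Qut: "?Q u \<le> ?Q t"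
      using t u r1 by (auto intro!: offspring_map_mono)
    have Q0: "0 \<le> ?Q u" using u Qu by linarith
    show ?thesis
    proof (cases "slack \<epsilon> C \<kappa> (?Q u / B) = \<epsilon>")
      case True
      then show ?thesis using Qr Qut by simp
    next
      case False
      then have sl: "slack \<epsilon> C \<kappa> (?Q u / B) = C * (?Q u / B) powr \<kappa>"
        and small: "C * (?Q u / B) powr \<kappa> < \<epsilon>"
        by (auto simp: slack_def min_def split: if_splits)
      \<comment> \<open>As the cap is not reached, \<open>u\<close> is so small that \<open>Q(u) / u\<close> is close to the mean.\<close>
      have "C * u powr \<kappa> \<le> C * ?Q u powr \<kappa>"
        using Qu u C0 \<kappa> by (intro mult_left_mono powr_mono2) auto
      also have "\<dots> = C * (?Q u / B) powr \<kappa> * B powr \<kappa>"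
        using Q0 B by (simp add: powr_divide)
      also have "\<dots> \<le> \<epsilon> * B powr \<kappa>"
        using small by (intro mult_right_mono) auto
      finally have "C * u powr \<kappa> * K \<le> \<epsilon> * B powr \<kappa> * K"
        using K by (rule mult_right_mono)
      also note C3
      finally have "C * (K * u powr \<kappa>) \<le> C * (m - m')" by (simp add: algebra_simps)
      then have Ku: "K * u powr \<kappa> \<le> m - m'" using C0 by simp
      have Qlow: "s * (m - K * s powr \<kappa>) \<le> ?Q s" if "0 \<le> s" "s \<le> 1" for s
        using offspring_map_linear(2)[OF that \<kappa> int int1] that
        by (simp add: m_def K_def powr_add algebra_simps)
      have "u * m' \<le> u * (m - K * u powr \<kappa>)" using Ku u by (intro mult_left_mono) auto
      also have "\<dots> \<le> ?Q u" using u u1 by (rule Qlow)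
      finally have Qm': "m' * u \<le> ?Q u" by (simp add: mult.commute)
      have tp: "t powr \<kappa> \<le> 2 * u powr \<kappa>"
        using powr_mono2[of \<kappa> t "2 * u"] powr_scale_le[of 2 u \<kappa>] t u \<kappa> by auto
      \<comment> \<open>Linearising \<open>Q\<close> at \<open>t = e u\<close> and at \<open>u\<close> costs the ratio at most \<open>4 K u powr \<kappa>\<close>.\<close>
      have "e * ?Q u - 4 * K * u powr \<kappa> * ?Q u \<le> e * ?Q u - 2 * e * K * u powr \<kappa> * u"
      proof -
        have "2 * e * K * u powr \<kappa> * u \<le> 4 * K * u powr \<kappa> * ?Q u"
          using e K u Qu by (intro mult_mono) auto
        then show ?thesis by simp
      qed
      also have "\<dots> \<le> e * (m * u) - 2 * e * K * u powr \<kappa> * u"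
        using offspring_map_linear(1)[OF u u1 \<kappa> int int1] e
        by (simp add: m_def[symmetric])
      also have "\<dots> = t * (m - K * (2 * u powr \<kappa>))" by (simp add: t_def algebra_simps)
      also have "\<dots> \<le> t * (m - K * t powr \<kappa>)"
        using tp K t u by (intro mult_left_mono diff_left_mono) auto
      also have "\<dots> \<le> ?Q t" using t u r1 by (intro Qlow) auto
      finally have main: "(e - 4 * K * u powr \<kappa>) * ?Q u \<le> ?Q r" using Qr by (simp add: algebra_simps)
      \<comment> \<open>The cost is paid by the growth of the slack from \<open>u\<close> to \<open>m' u / B\<close>.\<close>
      have "slack \<epsilon> C \<kappa> u + 4 * K * u powr \<kappa> \<le> C * u powr \<kappa> + C * \<eta> * u powr \<kappa>"
        using C2 by (intro add_mono mult_right_mono) (auto simp: slack_def)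
      also have "\<dots> = C * (m' * u / B) powr \<kappa>"
        using u m' B by (simp add: \<eta>_def powr_mult powr_divide algebra_simps)
      also have "\<dots> \<le> C * (?Q u / B) powr \<kappa>"
        using Qm' u m' B \<kappa> C0 by (intro mult_left_mono powr_mono2 divide_right_mono) auto
      finally have "1 + \<epsilon> - slack \<epsilon> C \<kappa> (?Q u / B) \<le> e - 4 * K * u powr \<kappa>"
        by (simp add: sl e_def)
      then have "(1 + \<epsilon> - slack \<epsilon> C \<kappa> (?Q u / B)) * ?Q u \<le> (e - 4 * K * u powr \<kappa>) * ?Q u"
        using Q0 by (rule mult_right_mono)
      then show ?thesis using main by linarith
    qed
  qed
  with C1 that show thesis by blast
qed

section \<open>Growth under averaging over the displacement\<close>

context real_distribution
begin

text \<open>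
  Moving an up-set that lies to the right of \<open>h + 1\<close> to the left multiplies its probability by
  \<open>exp (a h)\<close>. The set is moved by \<open>h + 1\<close> although the tail condition is used for \<open>h\<close> only: the
  spare unit makes it irrelevant whether the end point of the half-line belongs to the set.
\<close>

lemma shift_gain_upset:
  fixes a h :: real
  assumes tail: "\<And>x. 0 \<le> x \<Longrightarrow> measure M {x + h<..} \<le> exp (- a * h) * measure M {x<..}"
    and h: "0 \<le> h"
    and A: "\<And>y z. y \<in> A \<Longrightarrow> y \<le> z \<Longrightarrow> z \<in> A" "A \<subseteq> {h + 1<..}" "A \<in> sets borel"
  shows "exp (a * h) * measure M A \<le> measure M {y. y + (h + 1) \<in> A}"
proof (cases "A = {}")
  case False
  define c where "c = Inf A"
  have bdd: "bdd_below A" using A(2) by (auto intro!: bdd_belowI[of _ "h + 1"] less_imp_le)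
  have c: "h + 1 \<le> c"
    unfolding c_def using A(2) False by (intro cInf_greatest) (auto intro: less_imp_le)
  have A_sub: "A \<subseteq> {(c - 1 - h) + h<..}"
  proof
    fix y assume "y \<in> A"
    then have "c \<le> y" unfolding c_def using bdd by (rule cInf_lower)
    then show "y \<in> {(c - 1 - h) + h<..}" by simp
  qed
  have sub: "{c - 1 - h<..} \<subseteq> {y. y + (h + 1) \<in> A}"
  proof
    fix y assume "y \<in> {c - 1 - h<..}"
    then have "Inf A < y + (h + 1)" by (simp add: c_def)
    then obtain z where "z \<in> A" "z < y + (h + 1)"
      using cInf_lessD[OF False] by blast
    then show "y \<in> {y. y + (h + 1) \<in> A}" using A(1)[of z "y + (h + 1)"] by simp
  qed
  have meas: "{y. y + (h + 1) \<in> A} \<in> sets M"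
    using measurable_sets_borel[of "\<lambda>y::real. y + (h + 1)" borel A] A(3)
    by (simp add: vimage_def)
  have "measure M A \<le> measure M {(c - 1 - h) + h<..}"
    by (rule finite_measure_mono[OF A_sub]) simp
  also have "\<dots> \<le> exp (- a * h) * measure M {c - 1 - h<..}"
    using c by (intro tail) simp
  also have "\<dots> \<le> exp (- a * h) * measure M {y. y + (h + 1) \<in> A}"
    by (intro mult_left_mono finite_measure_mono[OF sub] meas) simp
  finally have "exp (a * h) * measure M A \<le>
      exp (a * h) * (exp (- a * h) * measure M {y. y + (h + 1) \<in> A})"
    by (intro mult_left_mono) auto
  also have "\<dots> = exp (a * h + - a * h) * measure M {y. y + (h + 1) \<in> A}"
    unfolding exp_add by simp
  finally show ?thesis by simp
qed simp

text \<open>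
  The same for increasing functions in place of up-sets, by integrating over their level sets.
\<close>

lemma shift_gain:
  fixes a h b :: real and g :: "real \<Rightarrow> real"
  assumes tail: "\<And>x. 0 \<le> x \<Longrightarrow> measure M {x + h<..} \<le> exp (- a * h) * measure M {x<..}"
    and h: "0 \<le> h"
    and g: "mono g" "\<And>y. 0 \<le> g y" "\<And>y. g y \<le> b" "\<And>y. y \<le> h + 1 \<Longrightarrow> g y = 0"
  shows "exp (a * h) * (\<integral>y. g y \<partial>M) \<le> (\<integral>y. g (y + (h + 1)) \<partial>M)"
proof -
  have [measurable]: "g \<in> borel_measurable borel" by (rule borel_measurable_mono[OF g(1)])
  have layer: "(\<integral>\<^sup>+ y. ennreal (f y) \<partial>M) =
      (\<integral>\<^sup>+ t. emeasure M {y. 0 \<le> t \<and> t < f y} \<partial>lborel)"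
    if [measurable]: "f \<in> borel_measurable borel" and f: "\<And>y. 0 \<le> f y" for f :: "real \<Rightarrow> real"
  proof -
    interpret pair_sigma_finite M lborel
      by (simp add: pair_sigma_finite.intro sigma_finite_measure_axioms sigma_finite_lborel)
    have "(\<integral>\<^sup>+ y. ennreal (f y) \<partial>M) =
        (\<integral>\<^sup>+ y. (\<integral>\<^sup>+ t. indicator {(y, t). 0 \<le> t \<and> t < f y} (y, t) \<partial>lborel) \<partial>M)"
    proof (rule nn_integral_cong)
      fix y
      have "(\<integral>\<^sup>+ t. indicator {(y, t). 0 \<le> t \<and> t < f y} (y, t) \<partial>lborel) =
          (\<integral>\<^sup>+ t. indicator {0..<f y} t \<partial>lborel)"
        by (intro nn_integral_cong) (simp split: split_indicator)
      then show "ennreal (f y) =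
          (\<integral>\<^sup>+ t. indicator {(y, t). 0 \<le> t \<and> t < f y} (y, t) \<partial>lborel)"
        using f by simp
    qed
    also have "\<dots> = (\<integral>\<^sup>+ t. (\<integral>\<^sup>+ y. indicator {(y, t). 0 \<le> t \<and> t < f y} (y, t) \<partial>M) \<partial>lborel)"
      by (rule Fubini[symmetric]) measurable
    also have "\<dots> = (\<integral>\<^sup>+ t. emeasure M {y. 0 \<le> t \<and> t < f y} \<partial>lborel)"
    proof (rule nn_integral_cong)
      fix t
      have "(\<integral>\<^sup>+ y. indicator {(y, t). 0 \<le> t \<and> t < f y} (y, t) \<partial>M) =
          (\<integral>\<^sup>+ y. indicator {y. 0 \<le> t \<and> t < f y} y \<partial>M)"
        by (intro nn_integral_cong) (simp split: split_indicator)
      also have "\<dots> = emeasure M {y. 0 \<le> t \<and> t < f y}"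
        by (rule nn_integral_indicator) measurable
      finally show "(\<integral>\<^sup>+ y. indicator {(y, t). 0 \<le> t \<and> t < f y} (y, t) \<partial>M) =
          emeasure M {y. 0 \<le> t \<and> t < f y}" .
    qed
    finally show ?thesis .
  qed
  have level: "ennreal (exp (a * h)) * emeasure M {y. 0 \<le> t \<and> t < g y} \<le>
      emeasure M {y. 0 \<le> t \<and> t < g (y + (h + 1))}" for t
  proof -
    have "exp (a * h) * measure M {y. 0 \<le> t \<and> t < g y} \<le>
        measure M {y. y + (h + 1) \<in> {y. 0 \<le> t \<and> t < g y}}"
    proof (rule shift_gain_upset[OF tail h])
      show "z \<in> {y. 0 \<le> t \<and> t < g y}" if "y \<in> {y. 0 \<le> t \<and> t < g y}" "y \<le> z" for y z
        using that monoD[OF g(1), of y z] by auto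
      show "{y. 0 \<le> t \<and> t < g y} \<subseteq> {h + 1<..}"
      proof
        fix y assume "y \<in> {y. 0 \<le> t \<and> t < g y}"
        then have "g y \<noteq> 0" by auto
        then show "y \<in> {h + 1<..}" using g(4)[of y] by force
      qed
    qed (auto)
    then show ?thesis
      by (simp add: emeasure_eq_measure ennreal_mult[symmetric])
  qed
  have ig: "integrable M g" "integrable M (\<lambda>y. g (y + (h + 1)))"
    using g by (auto intro!: integrable_const_bound[where B = b])
  have "ennreal (exp (a * h) * (\<integral>y. g y \<partial>M)) = ennreal (exp (a * h)) * (\<integral>\<^sup>+ y. ennreal (g y) \<partial>M)"
    using ig g by (simp add: nn_integral_eq_integral ennreal_mult)
  also have "\<dots> = (\<integral>\<^sup>+ t. ennreal (exp (a * h)) * emeasure M {y. 0 \<le> t \<and> t < g y} \<partial>lborel)"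
    using g by (simp add: layer nn_integral_cmult)
  also have "\<dots> \<le> (\<integral>\<^sup>+ t. emeasure M {y. 0 \<le> t \<and> t < g (y + (h + 1))} \<partial>lborel)"
    by (rule nn_integral_mono) (rule level)
  also have "\<dots> = (\<integral>\<^sup>+ y. ennreal (g (y + (h + 1))) \<partial>M)"
    using g by (intro layer[symmetric]) auto
  also have "\<dots> = ennreal (\<integral>y. g (y + (h + 1)) \<partial>M)"
    using ig g by (simp add: nn_integral_eq_integral)
  finally show ?thesis
    using g by (simp add: ennreal_le_iff)
qed

text \<open>
  Averaging over the displacement turns the improved slack, measured at \<open>v / B\<close>, back into the
  slack at the average \<open>w x\<close>. The obstacle is that \<open>v (x - y)\<close> may for large displacements \<open>y\<close> be
  much larger than its average \<open>w x\<close>, and there the hypothesis on \<open>v\<close> is too weak. If \<open>v\<close> is at least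
  \<open>B\<^sub>0\<close> times the average already at the moderate distance \<open>h + 1\<close>, then \<open>w\<close> has grown by the required factor
  when the argument has moved by \<open>L\<close> more, since displacements below \<open>-L\<close> are unlikely. If not, large
  values of \<open>v (x - y)\<close> come from displacements \<open>y > h + 1\<close> alone, and the tail condition makes these
  more likely by the factor \<open>exp (a h)\<close> when they may be shorter by \<open>h + 1\<close>.

  To use both sources of growth at once, the value \<open>b\<close> of the shifted tail is split as
  \<open>(b - \<phi> b) + \<phi> b\<close>, both summands increasing in \<open>b\<close>. The second one takes the gain from the tail
  condition and the first one the hypothesis on \<open>v\<close>. The function \<open>\<phi>\<close> is \<open>s\<close> times the excess of the
  slack at \<open>s / B\<close> over a little less than the slack that is wanted on average, so that it takes
  over where the hypothesis on \<open>v\<close> falls short.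
\<close>

lemma convolution_step:
  fixes v :: "real \<Rightarrow> real" and \<epsilon> C \<kappa> B B\<^sub>0 a h L x :: real
  defines "w \<equiv> \<lambda>x. \<integral>y. v (x - y) \<partial>M"
  assumes v: "antimono v" "\<And>z. 0 \<le> v z" "\<And>z. v z \<le> 1"
    and \<kappa>: "0 < \<kappa>" "\<kappa> \<le> 1" and \<epsilon>: "0 < \<epsilon>" "\<epsilon> \<le> 1 / 2" and C: "0 < C"
    and B: "1 < B\<^sub>0" "B\<^sub>0 < B" "1 + 2 * \<epsilon> \<le> (B / B\<^sub>0) powr \<kappa>"
    and tail: "\<And>x. 0 \<le> x \<Longrightarrow> measure M {x + h<..} \<le> exp (- a * h) * measure M {x<..}"
    and h: "0 \<le> h" "5 \<le> exp (a * h)"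
    and L: "0 \<le> L" "1 + \<epsilon> \<le> measure M {- L..} * B\<^sub>0"
    and hyp: "\<And>z. (1 + \<epsilon> - slack \<epsilon> C \<kappa> (v z / B)) * v z \<le> v (z - (h + 1 + L))"
  shows "(1 + \<epsilon> - slack \<epsilon> C \<kappa> (w x)) * w x \<le> w (x - (h + 1 + L))"
proof -
  have vmeas: "(\<lambda>z. v (c - z)) \<in> borel_measurable borel" for c
    by (rule borel_measurable_mono) (auto intro!: monoI antimonoD[OF v(1)])
  have iv: "integrable M (\<lambda>y. v (c - y))" for c
    using vmeas[of c] v by (auto intro!: integrable_const_bound[where B = 1])
  have w0: "0 \<le> w z" for z
    unfolding w_def by (rule Bochner_Integration.integral_nonneg) (simp add: v)
  have w_le: "w x \<le> w z" if "z \<le> x" for z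
    unfolding w_def
    by (rule integral_mono[OF iv iv]) (use that in \<open>auto intro!: antimonoD[OF v(1)]\<close>)
  have w_mono: "w x \<le> w (x - (h + 1 + L))"
    using h L by (intro w_le) simp
  define d where "d = slack \<epsilon> C \<kappa>"
  have d0: "0 \<le> d s" "d s \<le> \<epsilon>" for s
    using \<epsilon> C by (auto simp: d_def slack_le slack_nonneg)
  have d_mono: "d s \<le> d t" if "0 \<le> s" "s \<le> t" for s t
    unfolding d_def using that C \<kappa> by (intro slack_mono) auto
  have d_scale: "d (l * s) \<le> l * d s" if "1 \<le> l" "0 \<le> s" for l s
    unfolding d_def using that C \<kappa> \<epsilon> by (intro slack_scale_le) auto
  consider "d (w x) = \<epsilon>" | "B\<^sub>0 * w x \<le> v (x - (h + 1))"
    | "d (w x) \<noteq> \<epsilon>" "v (x - (h + 1)) < B\<^sub>0 * w x" by linarith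
  then show ?thesis
  proof cases
    case 1
    then show ?thesis using w_mono by (simp add: d_def)
  next
    case 2
    have "(1 + \<epsilon>) * w x \<le> measure M {- L..} * B\<^sub>0 * w x"
      using L(2) w0 by (rule mult_right_mono)
    also have "\<dots> = measure M {- L..} * (B\<^sub>0 * w x)" by simp
    also have "\<dots> \<le> measure M {- L..} * v (x - (h + 1))"
      using 2 by (rule mult_left_mono) simp
    also have "\<dots> = (\<integral>y. indicator {- L..} y * v (x - (h + 1)) \<partial>M)" by simp
    also have "\<dots> \<le> w (x - (h + 1 + L))"
      unfolding w_def
    proof (rule integral_mono)
      show "indicator {- L..} y * v (x - (h + 1)) \<le> v (x - (h + 1 + L) - y)" for y
        using v(2) by (auto split: split_indicator intro!: antimonoD[OF v(1)])
    qed (auto intro!: iv simp: less_top[symmetric])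
    finally show ?thesis
      using d0(1)[of "w x"] w0[of x] by (simp add: d_def[symmetric] algebra_simps) (smt (verit) mult_nonneg_nonneg)
  next
    case 3
    have dw: "d (w x) = C * w x powr \<kappa>"
      using 3(1) by (auto simp: d_def slack_def min_def split: if_splits)
    \<comment> \<open>The factor \<open>1 + 2 \<epsilon>\<close> leaves room for the loss in \<open>\<phi>\<close> when its argument grows by \<open>1 + \<epsilon>\<close>.\<close>
    define d' where "d' = d (w x) / (1 + 2 * \<epsilon>)"
    have d': "0 \<le> d'" "d' * (1 + 2 * \<epsilon>) = d (w x)" using d0 \<epsilon> by (auto simp: d'_def)
    define g where "g s = max 0 (d (s / B) - d')" for s
    define \<phi> where "\<phi> s = s * g s" for s
    have Bp: "0 < B" "0 < B\<^sub>0" using B by auto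
    have g: "0 \<le> g s" "g s \<le> \<epsilon>" for s
      using d0[of "s / B"] d'(1) \<epsilon> by (auto simp: g_def)
    have g_mono: "g s \<le> g t" if "0 \<le> s" "s \<le> t" for s t
      using d_mono[of "s / B" "t / B"] that Bp by (auto simp: g_def divide_right_mono)
    have \<phi>_mono: "\<phi> s \<le> \<phi> t" if "0 \<le> s" "s \<le> t" for s t
      unfolding \<phi>_def using that g g_mono by (intro mult_mono) auto
    \<comment> \<open>Since \<open>d s / s\<close> decreases, \<open>\<phi>\<close> has slope at most twice the cap \<open>\<epsilon> \<le> 1 / 2\<close>.\<close>
    have rest_mono: "s - \<phi> s \<le> t - \<phi> t" if "0 \<le> s" "s \<le> t" for s t
    proof (cases "s = t \<or> g t = 0")
      case True
      then show ?thesis using mult_nonneg_nonneg[OF that(1) g(1)[of s]] that by (auto simp: \<phi>_def)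
    next
      case False
      then have gt: "g t = d (t / B) - d'" and "0 < t" "s < t"
        using that by (auto simp: g_def max_def split: if_splits)
      show ?thesis
      proof (cases "s = 0")
        case True
        have "t * g t \<le> t * 1" using g[of t] \<epsilon> \<open>0 < t\<close> by (intro mult_left_mono) auto
        then show ?thesis using True by (simp add: \<phi>_def)
      next
        case False
        then have s: "0 < s" using that by simp
        have "d (t / B) \<le> t / s * d (s / B)"
          using d_scale[of "t / s" "s / B"] s that Bp by simp
        then have "s * d (t / B) \<le> t * d (s / B)" using s by (simp add: field_simps)
        then have "s * (s * d (t / B)) \<le> s * (t * d (s / B))" using s by simp
        then have gs: "t * (s * g s) \<ge> s * s * d (t / B) - t * s * d'"
        proof -
          have "t * (s * (d (s / B) - d')) \<le> t * (s * g s)"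
            using s \<open>0 < t\<close> by (intro mult_left_mono) (auto simp: g_def)
          with \<open>s * (s * d (t / B)) \<le> s * (t * d (s / B))\<close> show ?thesis by (simp add: algebra_simps)
        qed
        have "t * (t * g t - s * g s) \<le> d (t / B) * ((t - s) * (t + s)) - d' * (t * (t - s))"
          using gs by (simp add: gt algebra_simps)
        also have "\<dots> \<le> (1 / 2) * ((t - s) * (t + s))"
        proof -
          have "d (t / B) * ((t - s) * (t + s)) \<le> (1 / 2) * ((t - s) * (t + s))"
            using d0(2)[of "t / B"] \<epsilon> that by (intro mult_right_mono) auto
          moreover have "0 \<le> d' * (t * (t - s))" using d' that by simp
          ultimately show ?thesis by linarith
        qed
        also have "\<dots> \<le> (1 / 2) * ((t - s) * (2 * t))"
          using that by (intro mult_left_mono) auto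
        finally have "t * (t * g t - s * g s) \<le> t * (t - s)" by (simp add: algebra_simps)
        then have "t * g t - s * g s \<le> t - s" using \<open>0 < t\<close> by simp
        then show ?thesis by (simp add: \<phi>_def)
      qed
    qed
    \<comment> \<open>The excess slack is compensated by five times \<open>\<phi> s\<close>; the integral of \<open>\<phi>\<close> supplies this factor.\<close>
    have pointwise: "(1 + \<epsilon> - d (w x)) * s \<le> b - \<phi> b + 5 * \<phi> s"
      if s: "0 \<le> s" and b: "(1 + \<epsilon> - d (s / B)) * s \<le> b" for s b
    proof -
      define D where "D = d (s / B)"
      define r where "r = (1 + \<epsilon> - D) * s"
      have D: "0 \<le> D" "D \<le> \<epsilon>" using d0 by (auto simp: D_def)
      have r: "s \<le> r" "r \<le> (1 + \<epsilon>) * s"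
        using D s mult_right_mono[of 1 "1 + \<epsilon> - D" s] by (auto simp: r_def intro!: mult_right_mono)
      have "d (r / B) \<le> (1 + \<epsilon>) * D"
      proof -
        have "d (r / B) \<le> d ((1 + \<epsilon>) * (s / B))"
          using r s Bp by (intro d_mono) (auto simp: divide_right_mono)
        also have "\<dots> \<le> (1 + \<epsilon>) * D" unfolding D_def using s Bp \<epsilon> by (intro d_scale) auto
        finally show ?thesis .
      qed
      then have gr: "g r \<le> max 0 ((1 + \<epsilon>) * D - d')" by (auto simp: g_def)
      have "\<phi> r \<le> (1 + \<epsilon>) * s * max 0 ((1 + \<epsilon>) * D - d')"
        unfolding \<phi>_def using r s gr g by (intro mult_mono) auto
      moreover have "s * (D + (1 + \<epsilon>) * max 0 ((1 + \<epsilon>) * D - d')) \<le> s * (5 * max 0 (D - d') + d (w x))"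
      proof (intro mult_left_mono s)
        show "D + (1 + \<epsilon>) * max 0 ((1 + \<epsilon>) * D - d') \<le> 5 * max 0 (D - d') + d (w x)"
        proof (cases "D \<le> d'")
          case True
          have "(1 + \<epsilon>) * D \<le> (1 + \<epsilon>) * d'" using True \<epsilon> by (intro mult_left_mono) auto
          then have "max 0 ((1 + \<epsilon>) * D - d') \<le> \<epsilon> * d'" using \<epsilon> d' by (auto simp: algebra_simps)
          then have "(1 + \<epsilon>) * max 0 ((1 + \<epsilon>) * D - d') \<le> (1 + \<epsilon>) * (\<epsilon> * d')"
            using \<epsilon> by (intro mult_left_mono) auto
          also have "\<dots> \<le> 2 * (\<epsilon> * d')" using \<epsilon> d' by (intro mult_right_mono) auto
          finally show ?thesis using d' True by (simp add: algebra_simps)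
        next
          case False
          define \<Delta> where "\<Delta> = D - d'"
          have \<Delta>: "0 < \<Delta>" "D = d' + \<Delta>" using False by (auto simp: \<Delta>_def)
          have e: "\<epsilon> * \<Delta> \<le> (1 / 2) * \<Delta>" "\<epsilon> * (\<epsilon> * \<Delta>) \<le> (1 / 2) * (\<epsilon> * \<Delta>)"
              "\<epsilon> * (\<epsilon> * d') \<le> (1 / 2) * (\<epsilon> * d')"
            by (rule mult_right_mono; use \<Delta> \<epsilon> d' in simp)+
          have nn: "0 \<le> (1 + \<epsilon>) * D - d'" "0 \<le> \<epsilon> * d'"
            using \<Delta> \<epsilon> d' by (auto simp: algebra_simps)
          have "D + (1 + \<epsilon>) * ((1 + \<epsilon>) * D - d') =
              d' + \<epsilon> * d' + \<epsilon> * (\<epsilon> * d') + 2 * \<Delta> + 2 * (\<epsilon> * \<Delta>) + \<epsilon> * (\<epsilon> * \<Delta>)"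
            by (simp add: \<Delta>(2) algebra_simps)
          moreover have "d' + 2 * (\<epsilon> * d') = d (w x)" using d' by (simp add: algebra_simps)
          ultimately have "D + (1 + \<epsilon>) * ((1 + \<epsilon>) * D - d') \<le> 5 * \<Delta> + d (w x)"
            using \<Delta>(1) e nn(2) by linarith
          then show ?thesis using nn(1) \<Delta>(1) by (simp add: max_absorb2 \<Delta>_def)
        qed
      qed
      moreover have "\<phi> s = s * max 0 (D - d')" by (simp add: \<phi>_def g_def D_def)
      ultimately have "(1 + \<epsilon> - d (w x)) * s \<le> r - \<phi> r + 5 * \<phi> s"
        by (simp add: r_def algebra_simps)
      also have "r - \<phi> r \<le> b - \<phi> b"
        using r s b by (intro rest_mono) (auto simp: r_def D_def)
      finally show ?thesis by simp
    qed
    define V where "V y = v (x - y)" for y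
    define b where "b y = v (x - (h + 1 + L) - y)" for y
    have V: "0 \<le> V y" "V y \<le> 1" for y
      using v by (auto simp: V_def)
    have V_mono: "V y \<le> V z" if "y \<le> z" for y z
      using that by (auto simp: V_def intro!: antimonoD[OF v(1)])
    have b: "0 \<le> b y" "b y \<le> 1" "V (y + (h + 1)) \<le> b y" for y
      using v L by (auto simp: V_def b_def intro!: antimonoD[OF v(1)])
    have \<phi>1: "0 \<le> \<phi> s" "\<phi> s \<le> 1" if "0 \<le> s" "s \<le> 1" for s
    proof -
      show "0 \<le> \<phi> s" using that g by (simp add: \<phi>_def)
      have "\<phi> s \<le> 1 * 1"
        unfolding \<phi>_def using that g[of s] \<epsilon> by (intro mult_mono) auto
      then show "\<phi> s \<le> 1" by simp
    qed
    have \<phi>V_mono: "mono (\<lambda>y. \<phi> (V y))" using V V_mono by (auto intro!: monoI \<phi>_mono)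
    have \<phi>b_mono: "mono (\<lambda>y. \<phi> (b y))"
      using b by (intro monoI \<phi>_mono) (auto simp: b_def intro!: antimonoD[OF v(1)])
    note [measurable] = borel_measurable_mono[OF \<phi>V_mono] borel_measurable_mono[OF \<phi>b_mono]
    have int: "integrable M (\<lambda>y. \<phi> (V y))" "integrable M (\<lambda>y. \<phi> (b y))"
        "integrable M (\<lambda>y. \<phi> (V (y + (h + 1))))"
      using V b \<phi>1 by (auto intro!: integrable_const_bound[where B = 1])
    have ib: "integrable M b" "integrable M V" unfolding b_def V_def by (rule iv)+
    \<comment> \<open>Here \<open>v (x - (h + 1)) < B\<^sub>0 * w x\<close> with \<open>B\<^sub>0 < B\<close> is used: the slack there is smaller by \<open>(B / B\<^sub>0) powr \<kappa>\<close>.\<close>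
    have zero: "\<phi> (V y) = 0" if "y \<le> h + 1" for y
    proof -
      have "V y \<le> v (x - (h + 1))" using that by (auto simp: V_def intro!: antimonoD[OF v(1)])
      then have "V y / B \<le> B\<^sub>0 / B * w x" using 3(2) Bp by (simp add: field_simps)
      then have "d (V y / B) \<le> d (B\<^sub>0 / B * w x)" using V(1)[of y] Bp by (intro d_mono) auto
      also have "\<dots> \<le> C * (B\<^sub>0 / B * w x) powr \<kappa>" by (simp add: d_def slack_def)
      also have "\<dots> = d (w x) / (B / B\<^sub>0) powr \<kappa>"
        using Bp w0[of x] by (simp add: dw powr_mult powr_divide field_simps)
      also have "\<dots> \<le> d'"
        unfolding d'_def using B \<epsilon> d0 by (intro divide_left_mono) auto
      finally have "g (V y) = 0" by (simp add: g_def)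
      then show ?thesis by (simp add: \<phi>_def)
    qed
    have "5 * (\<integral>y. \<phi> (V y) \<partial>M) \<le> exp (a * h) * (\<integral>y. \<phi> (V y) \<partial>M)"
      using h V \<phi>1 by (intro mult_right_mono Bochner_Integration.integral_nonneg) auto
    also have "\<dots> \<le> (\<integral>y. \<phi> (V (y + (h + 1))) \<partial>M)"
      using V \<phi>1 zero by (intro shift_gain[where b = 1] tail h \<phi>V_mono) auto
    also have "\<dots> \<le> (\<integral>y. \<phi> (b y) \<partial>M)"
      using V b by (intro integral_mono int \<phi>_mono) auto
    finally have gain: "5 * (\<integral>y. \<phi> (V y) \<partial>M) \<le> (\<integral>y. \<phi> (b y) \<partial>M)" .
    have "(1 + \<epsilon> - d (w x)) * w x = (\<integral>y. (1 + \<epsilon> - d (w x)) * V y \<partial>M)"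
      by (simp add: w_def V_def)
    also have "\<dots> \<le> (\<integral>y. b y - \<phi> (b y) + 5 * \<phi> (V y) \<partial>M)"
    proof (rule integral_mono)
      fix y
      have "(1 + \<epsilon> - d (V y / B)) * V y \<le> b y"
        using hyp[of "x - y"] by (simp add: V_def b_def d_def algebra_simps)
      then show "(1 + \<epsilon> - d (w x)) * V y \<le> b y - \<phi> (b y) + 5 * \<phi> (V y)"
        using V(1)[of y] by (intro pointwise) auto
    qed (use int ib in auto)
    also have "\<dots> = (\<integral>y. b y \<partial>M) - (\<integral>y. \<phi> (b y) \<partial>M) + 5 * (\<integral>y. \<phi> (V y) \<partial>M)"
      using int ib by simp
    also have "\<dots> \<le> (\<integral>y. b y \<partial>M)" using gain by simp
    finally show ?thesis by (simp add: w_def b_def d_def)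
  qed
qed

end

section \<open>The recursion for the tails\<close>

text \<open>
  This is the probability that the maximal displacement at time \<open>n\<close> exceeds \<open>x\<close>, computed by
  conditioning on the displacement \<open>y\<close> and the offspring number of the initial particle.
\<close>

primrec brw_tail :: "nat pmf \<Rightarrow> real measure \<Rightarrow> nat \<Rightarrow> real \<Rightarrow> real" where
  "brw_tail p \<mu> 0 x = (if x < 0 then 1 else 0)"
| "brw_tail p \<mu> (Suc n) x = (\<integral>y. offspring_map p (brw_tail p \<mu> n (x - y)) \<partial>\<mu>)"

context real_distribution
begin

lemma escape_bound:
  fixes \<gamma> :: real
  assumes "0 < \<gamma>"
  obtains L where "0 \<le> L" "1 - \<gamma> \<le> measure M {- L..}" "measure M {L<..} \<le> \<gamma>"
proof -
  have "\<forall>\<^sub>F x in at_top. dist (cdf M x) 1 < \<gamma>"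
    using cdf_lim_at_top_prob assms by (rule tendstoD)
  moreover have "\<forall>\<^sub>F x in at_top. dist (cdf M (- x)) 0 < \<gamma>"
    using filterlim_compose[OF cdf_lim_at_bot filterlim_uminus_at_bot_at_top] assms by (rule tendstoD)
  ultimately have "\<forall>\<^sub>F x in at_top. dist (cdf M x) 1 < \<gamma> \<and> dist (cdf M (- x)) 0 < \<gamma> \<and> 0 \<le> x"
    using eventually_ge_at_top[of 0] by eventually_elim auto
  then obtain L where L: "dist (cdf M L) 1 < \<gamma>" "dist (cdf M (- L)) 0 < \<gamma>" "0 \<le> L"
    using eventually_happens'[OF trivial_limit_at_top_linorder] by blast
  have compl: "measure M {z<..} = 1 - cdf M z" for z
    using prob_compl[of "{..z}"] by (simp add: cdf_def Compl_eq_Diff_UNIV[symmetric])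
  have "measure M {- L<..} \<le> measure M {- L..}" by (intro finite_measure_mono) auto
  then show thesis using L compl[of L] compl[of "- L"] by (intro that[of L]) (auto simp: dist_real_def)
qed

lemma brw_tail_basic:
  shows brw_tail_nonneg: "0 \<le> brw_tail p M n x"
    and brw_tail_le_1: "brw_tail p M n x \<le> 1"
    and brw_tail_antimono: "x \<le> y \<Longrightarrow> brw_tail p M n y \<le> brw_tail p M n x"
    and integrable_brw_tail: "integrable M (\<lambda>z. offspring_map p (brw_tail p M n (x - z)))"
proof -
  have "(\<forall>x. 0 \<le> brw_tail p M n x \<and> brw_tail p M n x \<le> 1) \<and>
      (\<forall>x y. x \<le> y \<longrightarrow> brw_tail p M n y \<le> brw_tail p M n x) \<and>
      (\<forall>x. integrable M (\<lambda>z. offspring_map p (brw_tail p M n (x - z))))"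
  proof (induction n)
    have int: "integrable M (\<lambda>z. offspring_map p (u (x - z)))"
      if u: "\<And>x. 0 \<le> u x \<and> u x \<le> 1" "\<And>x y. x \<le> y \<Longrightarrow> u y \<le> u x" for u :: "real \<Rightarrow> real" and x
    proof (rule integrable_const_bound[where B = 1])
      have "mono (\<lambda>z. offspring_map p (u (x - z)))"
        using u by (intro monoI offspring_map_mono) auto
      then show "(\<lambda>z. offspring_map p (u (x - z))) \<in> borel_measurable M"
        using borel_measurable_mono by simp
      show "AE z in M. norm (offspring_map p (u (x - z))) \<le> 1"
        using u offspring_map_bounds by auto
    qed
    { case 0 then show ?case using int[of "\<lambda>x. if x < 0 then 1 else 0"] by auto }
    case (Suc n)
    have b: "0 \<le> brw_tail p M (Suc n) x" "brw_tail p M (Suc n) x \<le> 1" for x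
      using Suc offspring_map_bounds
      by (auto intro!: Bochner_Integration.integral_nonneg integral_le_const)
    have m: "brw_tail p M (Suc n) y \<le> brw_tail p M (Suc n) x" if "x \<le> y" for x y
      unfolding brw_tail.simps
      by (rule integral_mono) (use Suc that in \<open>auto intro!: offspring_map_mono\<close>)
    show ?case using b m int[of "brw_tail p M (Suc n)"] by blast
  qed
  then show "0 \<le> brw_tail p M n x" "brw_tail p M n x \<le> 1"
    "x \<le> y \<Longrightarrow> brw_tail p M n y \<le> brw_tail p M n x"
    "integrable M (\<lambda>z. offspring_map p (brw_tail p M n (x - z)))" by blast+
qed

end

section \<open>Uniform decay of the right tail\<close>

locale brw_laws = real_distribution M for M :: "real measure" +
  fixes p :: "nat pmf" and a M\<^sub>0 \<kappa> :: real
  assumes a: "0 < a"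
    and tail: "\<And>x h. 0 \<le> x \<Longrightarrow> M\<^sub>0 \<le> h \<Longrightarrow> measure M {x + h<..} \<le> exp (- a * h) * measure M {x<..}"
    and p: "set_pmf p \<subseteq> {1..}" "pmf p 1 < 1"
    and \<kappa>: "0 < \<kappa>" "\<kappa> \<le> 1"
    and int_powr: "integrable (measure_pmf p) (\<lambda>k. real k powr (1 + \<kappa>))"
begin

abbreviation u :: "nat \<Rightarrow> real \<Rightarrow> real" where "u \<equiv> brw_tail p M"

lemmas u_nonneg = brw_tail_nonneg[of p]
  and u_le_1 = brw_tail_le_1[of p]
  and u_antimono = brw_tail_antimono[where p = p]
  and integrable_Q_u = integrable_brw_tail[of p]

text \<open>
  The condition on the ratio is preserved by the recursion with the same constants, as the
  offspring map improves the slack by the factor that averaging over the displacement takes back.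
  The initial tail is the indicator of the negative half-line; where it is \<open>1\<close>, the slack is at the cap.
\<close>

lemma uniform_ratio:
  obtains S \<epsilon> C where "0 \<le> S" "0 < \<epsilon>" "0 < C"
    "\<forall>n x. (1 + \<epsilon> - slack \<epsilon> C \<kappa> (u n x)) * u n x \<le> u n (x - S)"
proof -
  define m where "m = measure_pmf.expectation p real"
  have m: "1 < m"
    unfolding m_def using p integrable_real_if_integrable_powr[OF \<kappa>(1) int_powr]
    by (rule offspring_mean_gt_1)
  \<comment> \<open>Any constants with \<open>1 < B\<^sub>0 < B < m\<close> will do.\<close>
  define B\<^sub>0 where "B\<^sub>0 = 1 + (m - 1) / 3"
  define B where "B = 1 + 2 * (m - 1) / 3"
  have B: "1 < B\<^sub>0" "B\<^sub>0 < B" "B < m" using m by (auto simp: B\<^sub>0_def B_def field_simps)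
  define \<epsilon> where "\<epsilon> = min (1 / 2) (min ((B\<^sub>0 - 1) / 2) (((B / B\<^sub>0) powr \<kappa> - 1) / 2))"
  have gB: "1 < (B / B\<^sub>0) powr \<kappa>" using B \<kappa> by (intro gr_one_powr) auto
  have \<epsilon>: "0 < \<epsilon>" "\<epsilon> \<le> 1 / 2" "\<epsilon> \<le> (B\<^sub>0 - 1) / 2" "\<epsilon> \<le> ((B / B\<^sub>0) powr \<kappa> - 1) / 2"
    using B gB by (auto simp: \<epsilon>_def min_def)
  obtain C where C: "\<epsilon> \<le> C"
    "\<And>v r. \<lbrakk>0 \<le> v; r \<le> 1; (1 + \<epsilon> - slack \<epsilon> C \<kappa> v) * v \<le> r\<rbrakk> \<Longrightarrow>
      (1 + \<epsilon> - slack \<epsilon> C \<kappa> (offspring_map p v / B)) * offspring_map p v \<le> offspring_map p r"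
    using offspring_step[OF p \<kappa> int_powr, of \<epsilon> B] \<epsilon> B by (auto simp: m_def)
  define \<gamma> where "\<gamma> = 1 - (1 + \<epsilon>) / B\<^sub>0"
  have \<gamma>: "0 < \<gamma>" using \<epsilon> B by (auto simp: \<gamma>_def field_simps)
  obtain L where L: "0 \<le> L" "1 - \<gamma> \<le> measure M {- L..}" using escape_bound[OF \<gamma>] by blast
  have L': "1 + \<epsilon> \<le> measure M {- L..} * B\<^sub>0"
    using L(2) B by (simp add: \<gamma>_def field_simps)
  define h where "h = max M\<^sub>0 (max 0 (ln 5 / a))"
  have h: "M\<^sub>0 \<le> h" "0 \<le> h" by (auto simp: h_def)
  have "ln 5 / a \<le> h" by (simp add: h_def)
  then have "ln 5 \<le> a * h" using a by (simp add: pos_divide_le_eq mult.commute)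
  then have h5: "5 \<le> exp (a * h)"
    using ln_le_cancel_iff[of 5 "exp (a * h)"] by simp
  define S where "S = h + 1 + L"
  have "(1 + \<epsilon> - slack \<epsilon> C \<kappa> (u n x)) * u n x \<le> u n (x - S)" for n x
  proof (induction n arbitrary: x)
    case 0
    then show ?case using C(1) h L by (auto simp: slack_def S_def)
  next
    case (Suc n)
    let ?v = "\<lambda>z. offspring_map p (u n z)"
    have "(1 + \<epsilon> - slack \<epsilon> C \<kappa> (\<integral>y. ?v (x - y) \<partial>M)) * (\<integral>y. ?v (x - y) \<partial>M)
        \<le> (\<integral>y. ?v (x - (h + 1 + L) - y) \<partial>M)"
    proof (rule convolution_step[of ?v \<kappa> \<epsilon> C B\<^sub>0 B h a L])
      show "antimono ?v"
        by (intro antimonoI offspring_map_mono u_nonneg u_le_1 u_antimono)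
      show "(1 + \<epsilon> - slack \<epsilon> C \<kappa> (?v z / B)) * ?v z \<le> ?v (z - (h + 1 + L))" for z
        using Suc[of z] by (intro C(2) u_nonneg u_le_1) (simp add: S_def)
      show "measure M {z + h<..} \<le> exp (- a * h) * measure M {z<..}" if "0 \<le> z" for z
        using that h by (intro tail)
    qed (use B C \<epsilon> \<kappa> h h5 L L' in \<open>auto intro!: offspring_map_bounds u_nonneg u_le_1\<close>)
    then show ?case by (simp add: S_def)
  qed
  with \<epsilon>(1) C(1) h L show thesis by (intro that[of S \<epsilon> C]) (auto simp: S_def)
qed

text \<open>
  Below the level \<open>\<delta>\<^sub>0\<close> at which the slack is \<open>\<epsilon> / 2\<close>, the tail decays geometrically at a rate
  that does not depend on the time.
\<close>

lemma uniform_right_tail: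
  obtains \<delta>\<^sub>0 where "0 < \<delta>\<^sub>0"
    "\<forall>\<delta>>0. \<exists>A. \<forall>n x y. u n x \<le> \<delta>\<^sub>0 \<longrightarrow> \<delta> \<le> u n y \<longrightarrow> y \<le> x + A"
proof -
  obtain S \<epsilon> C where S: "0 \<le> S" and \<epsilon>: "0 < \<epsilon>" and C: "0 < C"
    and ratio: "\<forall>n x. (1 + \<epsilon> - slack \<epsilon> C \<kappa> (u n x)) * u n x \<le> u n (x - S)"
    using uniform_ratio by blast
  define \<delta>\<^sub>0 where "\<delta>\<^sub>0 = (\<epsilon> / (2 * C)) powr (1 / \<kappa>)"
  have \<delta>\<^sub>0: "0 < \<delta>\<^sub>0" using \<epsilon> C by (auto simp: \<delta>\<^sub>0_def)
  have slack_half: "slack \<epsilon> C \<kappa> s \<le> \<epsilon> / 2" if "0 \<le> s" "s \<le> \<delta>\<^sub>0" for s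
  proof -
    have "s powr \<kappa> \<le> ((\<epsilon> / (2 * C)) powr (1 / \<kappa>)) powr \<kappa>"
      using that \<kappa> by (intro powr_mono2) (auto simp: \<delta>\<^sub>0_def)
    also have "\<dots> = \<epsilon> / (2 * C)" using \<kappa> \<epsilon> C by (simp add: powr_powr)
    finally show ?thesis using C by (simp add: slack_def field_simps min_def)
  qed
  have geometric: "(1 + \<epsilon> / 2) ^ j * u n (x + real j * S) \<le> u n x"
      if "u n x \<le> \<delta>\<^sub>0" for n x j
  proof (induction j)
    case (Suc j)
    let ?x = "x + real (Suc j) * S"
    have "u n ?x \<le> u n x" using S by (intro u_antimono) simp
    then have "slack \<epsilon> C \<kappa> (u n ?x) \<le> \<epsilon> / 2" using that by (intro slack_half u_nonneg) simp
    then have "(1 + \<epsilon> / 2) * u n ?x \<le> (1 + \<epsilon> - slack \<epsilon> C \<kappa> (u n ?x)) * u n ?x"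
      by (intro mult_right_mono u_nonneg) simp
    also have "\<dots> \<le> u n (?x - S)" by (rule ratio[rule_format])
    also have "?x - S = x + real j * S" by (simp add: algebra_simps)
    finally have "(1 + \<epsilon> / 2) ^ j * ((1 + \<epsilon> / 2) * u n ?x) \<le> (1 + \<epsilon> / 2) ^ j * u n (x + real j * S)"
      using \<epsilon> by (intro mult_left_mono) auto
    also note Suc
    finally show ?case by (simp add: mult_ac)
  qed simp
  have "\<exists>A. \<forall>n x y. u n x \<le> \<delta>\<^sub>0 \<longrightarrow> \<delta> \<le> u n y \<longrightarrow> y \<le> x + A" if \<delta>: "0 < \<delta>" for \<delta>
  proof -
    obtain j where j: "\<delta>\<^sub>0 / \<delta> < (1 + \<epsilon> / 2) ^ j"
      using real_arch_pow[of "1 + \<epsilon> / 2"] \<epsilon> by auto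
    have "y \<le> x + real j * S" if x: "u n x \<le> \<delta>\<^sub>0" and y: "\<delta> \<le> u n y" for n x y
    proof (rule ccontr)
      assume "\<not> y \<le> x + real j * S"
      then have "\<delta> \<le> u n (x + real j * S)" using y u_antimono[of "x + real j * S" y n] by linarith
      then have "(1 + \<epsilon> / 2) ^ j * \<delta> \<le> (1 + \<epsilon> / 2) ^ j * u n (x + real j * S)"
        using \<epsilon> by (intro mult_left_mono) auto
      also have "\<dots> \<le> \<delta>\<^sub>0" using geometric[OF x, of j] x by simp
      finally show False using j \<delta> by (simp add: field_simps)
    qed
    then show ?thesis by blast
  qed
  with \<delta>\<^sub>0 that show thesis by blast
qed

section \<open>Bounded width by going backward in time\<close>

text \<open>
  A one-step bound backward in time: if the tail is small at \<open>x\<close>, it was not much larger one unit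
  of time before at the point \<open>x + L\<close>, up to the probability of a displacement below \<open>-L\<close>.
\<close>

lemma one_step_back_low:
  fixes \<gamma> L :: real
  assumes L: "1 - \<gamma> \<le> measure M {- L..}"
  shows "offspring_map p (u n (x + L)) \<le> u (Suc n) x + \<gamma>"
proof -
  let ?q = "offspring_map p (u n (x + L))"
  have q: "0 \<le> ?q" "?q \<le> 1" by (intro offspring_map_bounds u_nonneg u_le_1)+
  have "?q - \<gamma> \<le> (1 - \<gamma>) * ?q \<or> \<gamma> < 0"
  proof (cases "\<gamma> < 0")
    case False
    then have "\<gamma> * ?q \<le> \<gamma> * 1" using q by (intro mult_left_mono) auto
    then show ?thesis by (simp add: algebra_simps)
  qed simp
  moreover have "\<not> \<gamma> < 0" using L prob_le_1[of "{- L..}"] by linarith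
  ultimately have "?q - \<gamma> \<le> (1 - \<gamma>) * ?q" by blast
  also have "\<dots> \<le> measure M {- L..} * ?q" using L q by (intro mult_right_mono) auto
  also have "\<dots> = (\<integral>y. indicator {- L..} y * ?q \<partial>M)" by simp
  also have "\<dots> \<le> u (Suc n) x"
    unfolding brw_tail.simps
  proof (rule integral_mono)
    show "indicator {- L..} y * ?q \<le> offspring_map p (u n (x - y))" for y
      by (auto split: split_indicator
          intro!: offspring_map_mono offspring_map_bounds u_antimono u_nonneg u_le_1)
  qed (auto intro!: integrable_Q_u simp: less_top[symmetric])
  finally show ?thesis by simp
qed

text \<open>
  Backward in time, a level below \<open>1\<close> falls by a fixed amount in each step, because the offspring
  map pushes levels between \<open>\<delta>\<^sub>0\<close> and \<open>1 - \<eta>\<close> up by a fixed amount. So it reaches \<open>\<delta>\<^sub>0\<close> after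
  a bounded number of steps, unless time \<open>0\<close> comes first, where a level below \<open>1\<close> is \<open>0\<close>.
\<close>

lemma back_low:
  fixes \<eta> \<delta>\<^sub>0 :: real
  assumes \<eta>: "0 < \<eta>" and \<delta>\<^sub>0: "0 < \<delta>\<^sub>0"
  obtains k L where
    "\<forall>n x. u n x \<le> 1 - \<eta> \<longrightarrow> (\<exists>i\<le>k. i \<le> n \<and> u (n - i) (x + real i * L) \<le> \<delta>\<^sub>0)"
proof -
  define c where "c = 1 - pmf p 1"
  have c: "0 < c" using p by (simp add: c_def)
  \<comment> \<open>Half of the gain \<open>c \<delta>\<^sub>0 \<eta> / 2\<close> of the offspring map is given up to the unlikely displacements.\<close>
  define \<gamma> where "\<gamma> = c * \<delta>\<^sub>0 * \<eta> / 4"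
  have \<gamma>: "0 < \<gamma>" using c \<delta>\<^sub>0 \<eta> by (simp add: \<gamma>_def)
  obtain L where L: "0 \<le> L" "1 - \<gamma> \<le> measure M {- L..}" using escape_bound[OF \<gamma>] by blast
  have step: "u n (x + L) \<le> u (Suc n) x - \<gamma>"
    if x: "u (Suc n) x \<le> 1 - \<eta>" and big: "\<delta>\<^sub>0 < u n (x + L)" for n x
  proof -
    let ?s = "u n (x + L)"
    have s: "0 \<le> ?s" "?s \<le> 1" by (intro u_nonneg u_le_1)+
    have Q: "?s + c * (?s * (1 - ?s)) \<le> u (Suc n) x + \<gamma>"
      using offspring_map_gain[OF s p(1)] one_step_back_low[OF L(2), of n x] by (simp add: c_def)
    have cs: "0 \<le> c * (?s * (1 - ?s))" using c s by simp
    have "c * \<delta>\<^sub>0 * \<eta> \<le> 1 * \<eta>"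
      using c s big \<delta>\<^sub>0 \<eta> mult_mono[of c 1 "\<delta>\<^sub>0" 1] by (intro mult_right_mono) (auto simp: c_def)
    then have "\<gamma> \<le> \<eta> / 4" by (simp add: \<gamma>_def)
    then have "\<eta> / 2 \<le> 1 - ?s" using Q cs x \<eta> by linarith
    then have "\<delta>\<^sub>0 * (\<eta> / 2) \<le> ?s * (1 - ?s)"
      using big \<delta>\<^sub>0 \<eta> s by (intro mult_mono) auto
    then have "c * (\<delta>\<^sub>0 * (\<eta> / 2)) \<le> c * (?s * (1 - ?s))"
      using c by (intro mult_left_mono) auto
    then show ?thesis using Q by (simp add: \<gamma>_def)
  qed
  define k where "k = nat \<lceil>1 / \<gamma>\<rceil>"
  have iter: "(\<exists>i\<le>j. i \<le> n \<and> u (n - i) (x + real i * L) \<le> \<delta>\<^sub>0) \<or>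
      (j \<le> n \<and> u (n - j) (x + real j * L) \<le> 1 - \<eta> - real j * \<gamma>)"
    if x: "u n x \<le> 1 - \<eta>" for n x j
  proof (induction j)
    case 0
    then show ?case using x by simp
  next
    case (Suc j)
    show ?case
    proof (cases "\<exists>i\<le>Suc j. i \<le> n \<and> u (n - i) (x + real i * L) \<le> \<delta>\<^sub>0")
      case False
      with Suc have j: "j \<le> n" and uj: "u (n - j) (x + real j * L) \<le> 1 - \<eta> - real j * \<gamma>"
        by (auto simp: le_Suc_eq)
      have "j \<noteq> n"
      proof
        assume "j = n"
        have "u (n - j) (x + real j * L) < 1"
          using uj \<eta> mult_nonneg_nonneg[of "real j" \<gamma>] \<gamma> by linarith
        with \<open>j = n\<close> have "u (n - j) (x + real j * L) = 0" by (auto split: if_splits)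
        then show False using False j \<delta>\<^sub>0 by (metis le_SucI less_imp_le order_refl)
      qed
      then have jn: "Suc j \<le> n" "n - j = Suc (n - Suc j)" using j by auto
      have "u (n - Suc j) (x + real j * L + L) \<le> u (n - j) (x + real j * L) - \<gamma>"
        unfolding jn(2)
      proof (rule step)
        show "u (Suc (n - Suc j)) (x + real j * L) \<le> 1 - \<eta>"
          using uj \<gamma> jn by (smt (verit) mult_nonneg_nonneg of_nat_0_le_iff)
        show "\<delta>\<^sub>0 < u (n - Suc j) (x + real j * L + L)"
          using False jn by (auto simp: algebra_simps not_le)
      qed
      then show ?thesis using uj jn by (auto simp: algebra_simps)
    qed simp
  qed
  have "\<exists>i\<le>k. i \<le> n \<and> u (n - i) (x + real i * L) \<le> \<delta>\<^sub>0" if x: "u n x \<le> 1 - \<eta>" for n x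
  proof -
    have "1 \<le> real k * \<gamma>"
      using \<gamma> by (simp add: k_def pos_divide_le_eq[symmetric] of_nat_ceiling)
    then have "\<not> u (n - k) (x + real k * L) \<le> 1 - \<eta> - real k * \<gamma>"
      using u_nonneg[of "n - k" "x + real k * L"] \<eta> by linarith
    then show ?thesis using iter[OF x, of k] by blast
  qed
  with that show thesis by blast
qed

text \<open>
  Backward in time, a positive level loses only a bounded factor per step: the offspring map
  multiplies by at most the mean, and displacements above \<open>L'\<close> carry little mass.
\<close>

lemma back_high:
  fixes \<delta> :: real
  assumes "0 < \<delta>"
  shows "\<exists>\<delta>' L. 0 < \<delta>' \<and> (\<forall>n x. j \<le> n \<longrightarrow> \<delta> \<le> u n x \<longrightarrow> \<delta>' \<le> u (n - j) (x - L))"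
proof (induction j)
  case 0
  show ?case using assms by (intro exI[of _ \<delta>] exI[of _ 0]) simp
next
  case (Suc j)
  then obtain \<delta>' L where \<delta>': "0 < \<delta>'"
    and IH: "\<And>n x. j \<le> n \<Longrightarrow> \<delta> \<le> u n x \<Longrightarrow> \<delta>' \<le> u (n - j) (x - L)" by blast
  define m where "m = measure_pmf.expectation p real"
  have int1: "integrable (measure_pmf p) real"
    by (rule integrable_real_if_integrable_powr[OF \<kappa>(1) int_powr])
  have m: "0 < m" using offspring_mean_gt_1[OF p int1] by (simp add: m_def)
  obtain L' where L': "measure M {L'<..} \<le> \<delta>' / 2" using escape_bound[of "\<delta>' / 2"] \<delta>' by auto
  have step: "\<delta>' / (2 * m) \<le> u n (x - L')" if "\<delta>' \<le> u (Suc n) x" for n x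
  proof -
    let ?q = "offspring_map p (u n (x - L'))"
    have q: "0 \<le> ?q" by (intro offspring_map_bounds u_nonneg u_le_1)
    have "u (Suc n) x \<le> (\<integral>y. ?q + indicator {L'<..} y \<partial>M)"
      unfolding brw_tail.simps
    proof (rule integral_mono)
      show "offspring_map p (u n (x - y)) \<le> ?q + indicator {L'<..} y" for y
      proof (cases "y \<le> L'")
        case True
        then show ?thesis by (auto intro!: offspring_map_mono u_nonneg u_le_1 u_antimono)
      next
        case False
        then show ?thesis using q offspring_map_bounds(2)[of "u n (x - y)" p] u_nonneg u_le_1
          by (simp add: add_increasing)
      qed
    qed (auto intro!: integrable_Q_u simp: less_top[symmetric])
    also have "\<dots> = ?q + measure M {L'<..}" using prob_space by (simp add: less_top[symmetric])
    also have "?q \<le> m * u n (x - L')"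
      unfolding m_def by (rule offspring_map_linear(1)[OF u_nonneg u_le_1 \<kappa> int_powr int1])
    finally have "\<delta>' / 2 \<le> m * u n (x - L')" using L' that by simp
    then show ?thesis using m by (simp add: field_simps)
  qed
  have "\<delta>' / (2 * m) \<le> u (n - Suc j) (x - (L + L'))" if "Suc j \<le> n" "\<delta> \<le> u n x" for n x
  proof -
    have "n - j = Suc (n - Suc j)" using that by simp
    then show ?thesis using IH[of n x] that step[of "n - Suc j" "x - L"] by (simp add: algebra_simps)
  qed
  then show ?case using \<delta>' m by (intro exI[of _ "\<delta>' / (2 * m)"] exI[of _ "L + L'"]) auto
qed

text \<open>
  Going back by the number of steps in which the level \<open>1 - \<eta>\<close> falls to \<open>\<delta>\<^sub>0\<close> moves both points by
  a bounded distance and turns \<open>\<delta>\<close> into a smaller positive level; so the distance is bounded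
  by the decay of the right tail at the earlier time.
\<close>

lemma bounded_width:
  fixes \<eta> \<delta> :: real
  assumes \<eta>: "0 < \<eta>" and \<delta>: "0 < \<delta>"
  obtains A where "\<And>n x y. u n x \<le> 1 - \<eta> \<Longrightarrow> \<delta> \<le> u n y \<Longrightarrow> y \<le> x + A"
proof -
  obtain \<delta>\<^sub>0 where \<delta>\<^sub>0: "0 < \<delta>\<^sub>0"
    and right: "\<forall>\<delta>>0. \<exists>A. \<forall>n x y. u n x \<le> \<delta>\<^sub>0 \<longrightarrow> \<delta> \<le> u n y \<longrightarrow> y \<le> x + A"
    using uniform_right_tail by blast
  obtain k L where low:
      "\<forall>n x. u n x \<le> 1 - \<eta> \<longrightarrow> (\<exists>i\<le>k. i \<le> n \<and> u (n - i) (x + real i * L) \<le> \<delta>\<^sub>0)"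
    using back_low[OF \<eta> \<delta>\<^sub>0] by blast
  define width_ok where "width_ok i A \<longleftrightarrow> (\<forall>n x y. i \<le> n \<longrightarrow>
    u (n - i) (x + real i * L) \<le> \<delta>\<^sub>0 \<longrightarrow> \<delta> \<le> u n y \<longrightarrow> y \<le> x + A)" for i A
  have "\<exists>A. width_ok i A" for i
  proof -
    obtain \<delta>' L' where \<delta>': "0 < \<delta>'" "\<And>n y. i \<le> n \<Longrightarrow> \<delta> \<le> u n y \<Longrightarrow> \<delta>' \<le> u (n - i) (y - L')"
      using back_high[OF \<delta>, of i] by blast
    obtain A where A: "\<And>n x y. u n x \<le> \<delta>\<^sub>0 \<Longrightarrow> \<delta>' \<le> u n y \<Longrightarrow> y \<le> x + A"
      using right \<delta>'(1) by blast
    have "y \<le> x + (real i * L + A + L')"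
      if "i \<le> n" "u (n - i) (x + real i * L) \<le> \<delta>\<^sub>0" "\<delta> \<le> u n y" for n x y
      using A[OF that(2) \<delta>'(2)[OF that(1,3)]] by simp
    then show ?thesis unfolding width_ok_def by blast
  qed
  then obtain A where A: "width_ok i (A i)" for i by metis
  have "y \<le> x + Max (A ` {..k})" if x: "u n x \<le> 1 - \<eta>" and y: "\<delta> \<le> u n y" for n x y
  proof -
    obtain i where i: "i \<le> k" "i \<le> n" "u (n - i) (x + real i * L) \<le> \<delta>\<^sub>0" using low x by blast
    have "A i \<le> Max (A ` {..k})" using i by (intro Max_ge) auto
    then show ?thesis using A[of i] i(2,3) y unfolding width_ok_def by force
  qed
  with that show thesis by blast
qed

end

section \<open>The maximal displacement satisfies the recursion\<close>

lemma particles_Suc_root: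
  "particles N (Suc n) \<omega> = (\<Union>i<N [] \<omega>. (#) i ` particles (\<lambda>u. N (i # u)) n \<omega>)"
proof (induction n)
  case (Suc n)
  have "particles N (Suc (Suc n)) \<omega> =
      (\<Union>i<N [] \<omega>. \<Union>u\<in>particles (\<lambda>u. N (i # u)) n \<omega>. (\<lambda>j. (i # u) @ [j]) ` {..<N (i # u) \<omega>})"
    by (subst particles.simps(2), subst Suc) auto
  also have "\<dots> = (\<Union>i<N [] \<omega>. (#) i ` particles (\<lambda>u. N (i # u)) (Suc n) \<omega>)"
    by (simp add: image_UN image_image)
  finally show ?case .
qed auto

lemma position_Cons:
  "position X (i # u) \<omega> = X [] \<omega> + position (\<lambda>u. X (i # u)) u \<omega>"
  by (simp add: position_def sum.lessThan_Suc_shift del: sum.lessThan_Suc)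

lemma particles_nonempty:
  assumes "\<And>u. 0 < N u \<omega>"
  shows "particles N n \<omega> \<noteq> {}"
  using assms by (induction n) (auto simp: lessThan_empty_iff bot_nat_def)

lemma max_displacement_le_iff:
  assumes "\<And>u. 0 < N u \<omega>"
  shows "max_displacement X N n \<omega> \<le> x \<longleftrightarrow> (\<forall>u\<in>particles N n \<omega>. position X u \<omega> \<le> x)"
  unfolding max_displacement_def
  using finite_particles[of N n \<omega>] particles_nonempty[of N \<omega> n] assms by (subst Max_le_iff) auto

text \<open>
  Positivity of the offspring numbers keeps all sets of particles nonempty; the maximum of the
  empty set would carry no information.
\<close>

lemma max_displacement_Suc_le_iff:
  assumes "\<And>u. 0 < N u \<omega>"
  shows "max_displacement X N (Suc n) \<omega> \<le> x \<longleftrightarrow>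
    (\<forall>i<N [] \<omega>. max_displacement (\<lambda>u. X (i # u)) (\<lambda>u. N (i # u)) n \<omega> \<le> x - X [] \<omega>)"
proof -
  have "max_displacement X N (Suc n) \<omega> \<le> x \<longleftrightarrow>
      (\<forall>i<N [] \<omega>. \<forall>u\<in>particles (\<lambda>u. N (i # u)) n \<omega>. position (\<lambda>u. X (i # u)) u \<omega> \<le> x - X [] \<omega>)"
    by (subst max_displacement_le_iff, rule assms, subst particles_Suc_root)
       (auto simp: position_Cons algebra_simps)
  then show ?thesis using assms by (simp add: max_displacement_le_iff)
qed

lemma max_displacement_cong:
  assumes "\<And>u. X u \<omega> = X' u \<omega>'" "\<And>u. N u \<omega> = N' u \<omega>'"
  shows "max_displacement X N n \<omega> = max_displacement X' N' n \<omega>'"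
proof -
  have "particles N n \<omega> = particles N' n \<omega>'"
    by (induction n) (auto simp: assms)
  then show ?thesis by (simp add: max_displacement_def position_def assms)
qed

text \<open>
  The set of particles takes countably many values, and on the event that it is a given finite
  set the maximal displacement is the maximum of finitely many random variables.
\<close>

lemma measurable_max_displacement:
  fixes M :: "'b measure" and X :: "nat list \<Rightarrow> 'b \<Rightarrow> real"
  assumes X [measurable]: "\<And>u. X u \<in> borel_measurable M"
    and N [measurable]: "\<And>u. N u \<in> measurable M (count_space UNIV)"
  shows "max_displacement X N n \<in> borel_measurable M"
proof -
  have mem [measurable]: "Measurable.pred M (\<lambda>\<omega>. v \<in> particles N n \<omega>)" for v n
  proof (induction n arbitrary: v)
    case (Suc n)
    note Suc [measurable]
    show ?case
    proof (cases v rule: rev_cases)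
      case Nil
      then have "(\<lambda>\<omega>. v \<in> particles N (Suc n) \<omega>) = (\<lambda>\<omega>. False)" by auto
      then show ?thesis by simp
    next
      case (snoc u i)
      have "(\<lambda>\<omega>. v \<in> particles N (Suc n) \<omega>) = (\<lambda>\<omega>. u \<in> particles N n \<omega> \<and> i < N u \<omega>)"
        by (auto simp: snoc)
      then show ?thesis by simp
    qed
  qed simp
  have "particles N n \<in> measurable M (count_space (Collect finite))"
  proof (subst measurable_count_space_eq_countable[OF countable_Collect_finite], safe)
    show "finite (particles N n \<omega>)" for \<omega> by (rule finite_particles)
    fix A :: "nat list set"
    have "particles N n -` {A} \<inter> space M =
        {\<omega> \<in> space M. \<forall>v. v \<in> particles N n \<omega> \<longleftrightarrow> v \<in> A}" by auto
    also have "\<dots> \<in> sets M" by measurable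
    finally show "particles N n -` {A} \<inter> space M \<in> sets M" .
  qed
  moreover have "(\<lambda>\<omega>. Max ((\<lambda>u. position X u \<omega>) ` A)) \<in> borel_measurable M"
    if "A \<in> Collect finite" for A
    using that unfolding position_def by (intro borel_measurable_Max) auto
  ultimately show ?thesis
    unfolding max_displacement_def[abs_def]
    using measurable_compose_countable'[OF _ _ countable_Collect_finite,
        where f = "\<lambda>A \<omega>. Max ((\<lambda>u. position X u \<omega>) ` A)" and g = "particles N n"] by blast
qed

lemma offspring_map_eq_suminf:
  assumes "0 \<le> s" "s \<le> 1"
  shows "(\<lambda>k. pmf p k * s ^ k) sums (1 - offspring_map p (1 - s))"
proof -
  have int: "integrable (measure_pmf p) (\<lambda>k. s ^ k)"
    using assms by (intro measure_pmf.integrable_const_bound[where B = 1]) (auto simp: power_le_one)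
  have "integrable (density (count_space UNIV) (pmf p)) (\<lambda>k. s ^ k)"
    using int by (simp add: measure_pmf_eq_density)
  then have "integrable (count_space UNIV) (\<lambda>k. pmf p k * s ^ k)"
    by (simp add: integrable_density)
  then have "(\<lambda>k. pmf p k * s ^ k) sums (\<integral>k. pmf p k * s ^ k \<partial>count_space UNIV)"
    by (rule sums_integral_count_space_nat)
  also have "(\<integral>k. pmf p k * s ^ k \<partial>count_space UNIV) = measure_pmf.expectation p (\<lambda>k. s ^ k)"
    by (simp add: measure_pmf_eq_density integral_density)
  also have "\<dots> = 1 - offspring_map p (1 - s)"
    using int by (simp add: offspring_map_def)
  finally show ?thesis .
qed

context branching_random_walk
begin

lemma max_displacement_measurable: "max_displacement X N n \<in> borel_measurable \<Omega>"
  using X_measurable N_measurable by (rule measurable_max_displacement)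

lemma real_distribution_X: "real_distribution (distr \<Omega> borel (X u))"
  using X_measurable by simp

lemma AE_offspring_pos:
  assumes "set_pmf p \<subseteq> {1..}"
  shows "AE \<omega> in \<Omega>. \<forall>u. 0 < N u \<omega>"
proof (subst AE_all_countable, rule allI)
  fix u
  have "AE k in measure_pmf p. 0 < k" using assms by (auto simp: AE_measure_pmf_iff)
  then have "AE k in distr \<Omega> (count_space UNIV) (N u). 0 < k" by (subst N_distribution)
  then show "AE \<omega> in \<Omega>. 0 < N u \<omega>" using N_measurable by (subst (asm) AE_distr_iff) auto
qed

text \<open>
  Re-indexing along the labels that start with \<open>i\<close> is a special case of regrouping an independent
  family into blocks, here blocks with one element each.
\<close>

lemma subtree: "branching_random_walk \<Omega> G p (\<lambda>u. X (i # u)) (\<lambda>u. N (i # u))"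
proof
  let ?Z = "case_sum X (\<lambda>u \<omega>. real (N u \<omega>))"
  let ?f = "map_sum ((#) i) ((#) i)"
  have "indep_vars (\<lambda>j. PiM {?f j} (\<lambda>_. borel)) (\<lambda>j \<omega>. restrict (\<lambda>k. ?Z k \<omega>) {?f j}) UNIV"
    using independent
    by (rule indep_vars_restrict)
       (auto simp: disjoint_family_on_def map_sum_def split: sum.splits)
  then have "indep_vars (\<lambda>_. borel) (\<lambda>j \<omega>. (\<lambda>g. g (?f j)) (restrict (\<lambda>k. ?Z k \<omega>) {?f j})) UNIV"
    by (rule indep_vars_compose2) auto
  also have "(\<lambda>j \<omega>. (\<lambda>g. g (?f j)) (restrict (\<lambda>k. ?Z k \<omega>) {?f j})) =
      case_sum (\<lambda>u. X (i # u)) (\<lambda>u \<omega>. real (N (i # u) \<omega>))"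
    by (auto simp: fun_eq_iff split: sum.splits)
  finally show "indep_vars (\<lambda>_. borel) (case_sum (\<lambda>u. X (i # u)) (\<lambda>u \<omega>. real (N (i # u) \<omega>))) UNIV" .
qed (use X_measurable N_measurable X_distribution N_distribution in auto)

text \<open>
  The number of children of the root and the maximal displacements of the different subtrees are
  functions of disjoint blocks of the independent family.
\<close>

lemma indep_root_and_subtrees:
  "indep_vars (\<lambda>_. borel) (\<lambda>j \<omega>. case j of None \<Rightarrow> real (N [] \<omega>)
     | Some i \<Rightarrow> max_displacement (\<lambda>u. X (i # u)) (\<lambda>u. N (i # u)) n \<omega>) UNIV"
proof -
  let ?Z = "case_sum X (\<lambda>u \<omega>. real (N u \<omega>))"
  define K :: "nat option \<Rightarrow> (nat list + nat list) set" where
    "K j = (case j of None \<Rightarrow> {Inr []} | Some i \<Rightarrow> range (\<lambda>u. Inl (i # u)) \<union> range (\<lambda>u. Inr (i # u)))" for j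
  \<comment> \<open>Rounding recovers the offspring numbers from their images among the reals.\<close>
  define Y :: "nat option \<Rightarrow> (nat list + nat list \<Rightarrow> real) \<Rightarrow> real" where
    "Y j = (case j of None \<Rightarrow> (\<lambda>g. g (Inr []))
      | Some i \<Rightarrow> max_displacement (\<lambda>u g. g (Inl (i # u))) (\<lambda>u g. nat \<lfloor>g (Inr (i # u))\<rfloor>) n)" for j
  have "indep_vars (\<lambda>j. PiM (K j) (\<lambda>_. borel)) (\<lambda>j \<omega>. restrict (\<lambda>k. ?Z k \<omega>) (K j)) UNIV"
    using independent
    by (rule indep_vars_restrict)
       (auto simp: disjoint_family_on_def K_def split: option.splits)
  then have "indep_vars (\<lambda>_. borel) (\<lambda>j \<omega>. Y j (restrict (\<lambda>k. ?Z k \<omega>) (K j))) UNIV"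
  proof (rule indep_vars_compose2)
    fix j
    show "Y j \<in> measurable (PiM (K j) (\<lambda>_. borel)) borel"
    proof (cases j)
      case None
      then show ?thesis by (auto simp: Y_def K_def)
    next
      case (Some i)
      have comp [measurable]: "(\<lambda>g. g (Inl (i # u))) \<in> borel_measurable (PiM (K (Some i)) (\<lambda>_. borel :: real measure))"
          "(\<lambda>g. g (Inr (i # u))) \<in> borel_measurable (PiM (K (Some i)) (\<lambda>_. borel :: real measure))" for u
        by (auto intro!: measurable_component_singleton simp: K_def)
      have "(\<lambda>r :: real. nat \<lfloor>r\<rfloor>) \<in> measurable borel (count_space UNIV)" by measurable
      then have "(\<lambda>g. nat \<lfloor>g (Inr (i # u))\<rfloor>) \<in> measurable (PiM (K (Some i)) (\<lambda>_. borel :: real measure)) (count_space UNIV)" for u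
        by (rule measurable_compose[OF comp(2)])
      then show ?thesis unfolding Y_def Some option.case
        by (intro measurable_max_displacement comp)
    qed
  qed
  also have "(\<lambda>j \<omega>. Y j (restrict (\<lambda>k. ?Z k \<omega>) (K j))) = (\<lambda>j \<omega>. case j of None \<Rightarrow> real (N [] \<omega>)
     | Some i \<Rightarrow> max_displacement (\<lambda>u. X (i # u)) (\<lambda>u. N (i # u)) n \<omega>)"
    by (auto simp: fun_eq_iff Y_def K_def split: option.splits intro!: max_displacement_cong)
  finally show ?thesis .
qed

text \<open>
  Setting the displacement of the root to \<open>0\<close> leaves a random variable that does not involve it.
\<close>

lemma indep_first_step:
  "indep_var borel (X []) borel (max_displacement (X([] := \<lambda>_. 0)) N n)"
proof -
  let ?Z = "case_sum X (\<lambda>u \<omega>. real (N u \<omega>))"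
  let ?A = "{Inl []} :: (nat list + nat list) set"
  define Y :: "(nat list + nat list \<Rightarrow> real) \<Rightarrow> real" where
    "Y = max_displacement ((\<lambda>u g. g (Inl u))([] := \<lambda>_. 0)) (\<lambda>u g. nat \<lfloor>g (Inr u)\<rfloor>) n"
  have "indep_var (PiM ?A (\<lambda>_. borel)) (\<lambda>\<omega>. restrict (\<lambda>k. ?Z k \<omega>) ?A)
      (PiM (- ?A) (\<lambda>_. borel)) (\<lambda>\<omega>. restrict (\<lambda>k. ?Z k \<omega>) (- ?A))"
    using independent by (rule indep_var_restrict) auto
  then have "indep_var borel ((\<lambda>g. g (Inl [])) \<circ> (\<lambda>\<omega>. restrict (\<lambda>k. ?Z k \<omega>) ?A))
      borel (Y \<circ> (\<lambda>\<omega>. restrict (\<lambda>k. ?Z k \<omega>) (- ?A)))"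
  proof (rule indep_var_compose)
    have [measurable]: "(\<lambda>g. g (Inr u)) \<in> borel_measurable (PiM (- ?A) (\<lambda>_. borel))" for u
      by (auto intro!: measurable_component_singleton)
    have "((\<lambda>u g. g (Inl u))([] := \<lambda>_. 0)) u \<in> borel_measurable (PiM (- ?A) (\<lambda>_. borel))" for u
      by (cases "u = []") (auto intro!: measurable_component_singleton)
    then show "Y \<in> measurable (PiM (- ?A) (\<lambda>_. borel)) borel"
      unfolding Y_def by (rule measurable_max_displacement) measurable
  qed (auto intro!: measurable_component_singleton)
  also have "(\<lambda>g. g (Inl [])) \<circ> (\<lambda>\<omega>. restrict (\<lambda>k. ?Z k \<omega>) ?A) = X []"
    by (auto simp: fun_eq_iff)
  also have "Y \<circ> (\<lambda>\<omega>. restrict (\<lambda>k. ?Z k \<omega>) (- ?A)) = max_displacement (X([] := \<lambda>_. 0)) N n"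
    by (auto simp: fun_eq_iff Y_def intro!: max_displacement_cong)
  finally show ?thesis .
qed

lemma prob_subtrees_le:
  assumes F: "\<And>i. prob {\<omega> \<in> space \<Omega>. max_displacement (\<lambda>u. X (i # u)) (\<lambda>u. N (i # u)) n \<omega> \<le> w} = s"
  shows "prob {\<omega> \<in> space \<Omega>. \<forall>i<N [] \<omega>. max_displacement (\<lambda>u. X (i # u)) (\<lambda>u. N (i # u)) n \<omega> \<le> w} =
    1 - offspring_map p (1 - s)"
proof -
  let ?M = "\<lambda>i. max_displacement (\<lambda>u. X (i # u)) (\<lambda>u. N (i # u)) n"
  note [measurable] = N_measurable
  have [measurable]: "?M i \<in> borel_measurable \<Omega>" for i
    by (rule branching_random_walk.max_displacement_measurable[OF subtree])
  define E where "E k = {\<omega> \<in> space \<Omega>. N [] \<omega> = k \<and> (\<forall>i<k. ?M i \<omega> \<le> w)}" for k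
  have E: "prob (E k) = pmf p k * s ^ k" for k
  proof -
    let ?V = "\<lambda>j \<omega>. case j of None \<Rightarrow> real (N [] \<omega>) | Some i \<Rightarrow> ?M i \<omega>"
    define A where "A j = (case j of None \<Rightarrow> {real k} | Some (i::nat) \<Rightarrow> {..w})" for j
    have "E k = (\<Inter>j\<in>insert None (Some ` {..<k}). ?V j -` A j \<inter> space \<Omega>)"
      by (auto simp: E_def A_def)
    also have "prob \<dots> = (\<Prod>j\<in>insert None (Some ` {..<k}). prob (?V j -` A j \<inter> space \<Omega>))"
      by (rule indep_varsD[OF indep_root_and_subtrees]) (auto simp: A_def split: option.splits)
    also have "\<dots> = prob (?V None -` A None \<inter> space \<Omega>) * (\<Prod>i<k. prob (?V (Some i) -` A (Some i) \<inter> space \<Omega>))"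
      by (subst prod.insert) (auto simp: prod.reindex)
    also have "prob (?V None -` A None \<inter> space \<Omega>) = measure (distr \<Omega> (count_space UNIV) (N [])) {k}"
      by (subst measure_distr) (auto simp: A_def intro!: arg_cong[where f = prob])
    also have "\<dots> = pmf p k" by (simp add: N_distribution measure_pmf_single)
    also have "(\<Prod>i<k. prob (?V (Some i) -` A (Some i) \<inter> space \<Omega>)) = (\<Prod>i<k. s)"
    proof (rule prod.cong[OF refl])
      fix i
      have "?V (Some i) -` A (Some i) \<inter> space \<Omega> = {\<omega> \<in> space \<Omega>. ?M i \<omega> \<le> w}"
        by (auto simp: A_def)
      then show "prob (?V (Some i) -` A (Some i) \<inter> space \<Omega>) = s" using F[of i] by simp
    qed
    finally show ?thesis by simp
  qed
  have s: "0 \<le> s" "s \<le> 1" using F[of 0] by auto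
  have "range E \<subseteq> sets \<Omega>" unfolding E_def by auto
  moreover have "disjoint_family E" by (auto simp: disjoint_family_on_def E_def)
  ultimately have "(\<lambda>k. prob (E k)) sums prob (\<Union>k. E k)" by (rule finite_measure_UNION)
  then have "prob (\<Union>k. E k) = 1 - offspring_map p (1 - s)"
    using offspring_map_eq_suminf[OF s, of p] unfolding E by (rule sums_unique2)
  also have "(\<Union>k. E k) = {\<omega> \<in> space \<Omega>. \<forall>i<N [] \<omega>. ?M i \<omega> \<le> w}" by (auto simp: E_def)
  finally show ?thesis .
qed

end

text \<open>
  The induction runs over all branching random walks with the given laws, since its hypothesis is
  applied to the subtrees at the children of the root. Up to a null set, the maximal displacement
  is the sum of the displacement of the root and an independent variable \<open>W\<close>, and \<open>W\<close> is bounded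
  by \<open>w\<close> if and only if the subtrees at the children of the root are.
\<close>

lemma prob_max_displacement_le:
  assumes "branching_random_walk \<Omega> G p X N" and p: "set_pmf p \<subseteq> {1..}"
    and \<mu>: "real_distribution \<mu>" "cdf \<mu> = G"
  shows "measure \<Omega> {\<omega> \<in> space \<Omega>. max_displacement X N n \<omega> \<le> x} = 1 - brw_tail p \<mu> n x"
  using assms(1)
proof (induction n arbitrary: X N x)
  case 0
  then interpret branching_random_walk \<Omega> G p X N .
  show ?case using prob_space by (simp add: max_displacement_def position_def)
next
  case (Suc n)
  then interpret branching_random_walk \<Omega> G p X N by -
  interpret \<mu>: real_distribution \<mu> by (rule \<mu>)
  note [measurable] = N_measurable X_measurable
  let ?M = "\<lambda>i. max_displacement (\<lambda>u. X (i # u)) (\<lambda>u. N (i # u)) n"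
  have [measurable]: "?M i \<in> borel_measurable \<Omega>" for i
    by (rule branching_random_walk.max_displacement_measurable[OF subtree])
  define W where "W = max_displacement (X([] := \<lambda>_. 0)) N (Suc n)"
  have W_rv [measurable]: "W \<in> borel_measurable \<Omega>"
    unfolding W_def by (rule measurable_max_displacement) auto
  have [measurable]: "max_displacement X N (Suc n) \<in> borel_measurable \<Omega>"
    by (rule max_displacement_measurable)
  have distr_X: "distr \<Omega> borel (X []) = \<mu>"
    by (rule cdf_unique[OF real_distribution_X \<mu>(1)]) (simp add: X_distribution \<mu>(2))
  have W_iff: "W \<omega> \<le> w \<longleftrightarrow> (\<forall>i<N [] \<omega>. ?M i \<omega> \<le> w)" if "\<forall>u. 0 < N u \<omega>" for \<omega> w
    unfolding W_def using that by (subst max_displacement_Suc_le_iff) auto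
  have prob_W: "prob {\<omega> \<in> space \<Omega>. W \<omega> \<le> w} = 1 - offspring_map p (brw_tail p \<mu> n w)" for w
  proof -
    have "prob {\<omega> \<in> space \<Omega>. W \<omega> \<le> w} = prob {\<omega> \<in> space \<Omega>. \<forall>i<N [] \<omega>. ?M i \<omega> \<le> w}"
      by (rule finite_measure_eq_AE) (use AE_offspring_pos[OF p] W_iff in auto)
    also have "\<dots> = 1 - offspring_map p (1 - (1 - brw_tail p \<mu> n w))"
      by (rule prob_subtrees_le) (rule Suc.IH[OF subtree])
    finally show ?thesis by simp
  qed
  have "Measurable.pred (borel \<Otimes>\<^sub>M borel) (\<lambda>z :: real \<times> real. snd z \<le> x - fst z)" by measurable
  then have S: "{z :: real \<times> real. snd z \<le> x - fst z} \<in> sets (borel \<Otimes>\<^sub>M borel)"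
    by (simp add: pred_def space_pair_measure)
  have "prob {\<omega> \<in> space \<Omega>. max_displacement X N (Suc n) \<omega> \<le> x} =
      prob {\<omega> \<in> space \<Omega>. W \<omega> \<le> x - X [] \<omega>}"
  proof (rule finite_measure_eq_AE)
    show "AE \<omega> in \<Omega>. (\<omega> \<in> {\<omega> \<in> space \<Omega>. max_displacement X N (Suc n) \<omega> \<le> x}) =
        (\<omega> \<in> {\<omega> \<in> space \<Omega>. W \<omega> \<le> x - X [] \<omega>})"
      using AE_offspring_pos[OF p] by eventually_elim (simp add: W_iff max_displacement_Suc_le_iff)
  qed auto
  also have "ennreal \<dots> = emeasure (distr \<Omega> (borel \<Otimes>\<^sub>M borel) (\<lambda>\<omega>. (X [] \<omega>, W \<omega>))) {z. snd z \<le> x - fst z}"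
    by (subst emeasure_distr)
       (auto simp: emeasure_eq_measure S[unfolded borel_prod] S intro!: arg_cong[where f = prob])
  also have "distr \<Omega> (borel \<Otimes>\<^sub>M borel) (\<lambda>\<omega>. (X [] \<omega>, W \<omega>)) = \<mu> \<Otimes>\<^sub>M distr \<Omega> borel W"
    using indep_first_step[of "Suc n"] by (simp add: indep_var_distribution_eq distr_X W_def)
  also have "emeasure (\<mu> \<Otimes>\<^sub>M distr \<Omega> borel W) {z. snd z \<le> x - fst z} =
      (\<integral>\<^sup>+ y. emeasure (distr \<Omega> borel W) (Pair y -` {z. snd z \<le> x - fst z}) \<partial>\<mu>)"
  proof (rule sigma_finite_measure.emeasure_pair_measure_alt)
    interpret W: prob_space "distr \<Omega> borel W" by (rule prob_space_distr) simp
    show "sigma_finite_measure (distr \<Omega> borel W)" ..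
    have "sets (\<mu> \<Otimes>\<^sub>M distr \<Omega> borel W) = sets (borel \<Otimes>\<^sub>M borel)"
      by (rule sets_pair_measure_cong) auto
    then show "{z. snd z \<le> x - fst z} \<in> sets (\<mu> \<Otimes>\<^sub>M distr \<Omega> borel W)"
      using S by (simp only:)
  qed
  also have "\<dots> = (\<integral>\<^sup>+ y. ennreal (1 - offspring_map p (brw_tail p \<mu> n (x - y))) \<partial>\<mu>)"
  proof (rule nn_integral_cong)
    fix y
    have "emeasure (distr \<Omega> borel W) (Pair y -` {z. snd z \<le> x - fst z}) =
        emeasure \<Omega> {\<omega> \<in> space \<Omega>. W \<omega> \<le> x - y}"
      by (subst emeasure_distr) (auto intro!: arg_cong[where f = "emeasure \<Omega>"])
    then show "emeasure (distr \<Omega> borel W) (Pair y -` {z. snd z \<le> x - fst z}) =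
        ennreal (1 - offspring_map p (brw_tail p \<mu> n (x - y)))"
      by (simp add: emeasure_eq_measure prob_W)
  qed
  also have "\<dots> = ennreal (\<integral>y. 1 - offspring_map p (brw_tail p \<mu> n (x - y)) \<partial>\<mu>)"
    by (rule nn_integral_eq_integral)
       (auto intro!: \<mu>.integrable_brw_tail offspring_map_bounds \<mu>.brw_tail_nonneg \<mu>.brw_tail_le_1)
  also have "(\<integral>y. 1 - offspring_map p (brw_tail p \<mu> n (x - y)) \<partial>\<mu>) = 1 - brw_tail p \<mu> (Suc n) x"
    using \<mu>.prob_space by (simp add: \<mu>.integrable_brw_tail)
  finally show ?case
    using \<mu>.brw_tail_le_1[of p "Suc n" x] by (simp del: brw_tail.simps)
qed


section \<open>Tightness\<close>

lemma (in real_distribution) less_median: "x < median (cdf M) \<Longrightarrow> cdf M x < 1 / 2"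
  and median_less: "median (cdf M) < x \<Longrightarrow> 1 / 2 \<le> cdf M x"
proof -
  let ?S = "{x. 1 / 2 \<le> cdf M x}"
  have "\<forall>\<^sub>F x in at_bot. cdf M x < 1 / 2"
    using cdf_lim_at_bot by (rule order_tendstoD) simp
  then obtain l where l: "\<And>x. x \<le> l \<Longrightarrow> cdf M x < 1 / 2"
    by (auto simp: eventually_at_bot_linorder)
  have bdd: "bdd_below ?S" using l by (intro bdd_belowI[of _ l]) (force simp: not_less[symmetric])
  have "\<forall>\<^sub>F x in at_top. 1 / 2 < cdf M x"
    using cdf_lim_at_top_prob by (rule order_tendstoD) simp
  then obtain r where "1 / 2 < cdf M r" by (auto simp: eventually_at_top_linorder)
  then have ne: "?S \<noteq> {}" by (auto intro: less_imp_le)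
  show "cdf M x < 1 / 2" if "x < median (cdf M)"
    using cInf_lower[OF _ bdd, of x] that by (force simp: median_def)
  show "1 / 2 \<le> cdf M x" if "median (cdf M) < x"
  proof -
    have "Inf ?S < x" using that by (simp add: median_def)
    then obtain y where "1 / 2 \<le> cdf M y" "y < x"
      using cInf_lessD[OF ne] by blast
    then show ?thesis using cdf_nondecreasing[of y x] by linarith
  qed
qed

theorem theorem1p1:
  fixes G :: "real \<Rightarrow> real" and a M\<^sub>0 \<theta> :: real and p :: "nat pmf"
    and \<Omega> :: "'a measure"
    and X :: "nat list \<Rightarrow> 'a \<Rightarrow> real" and N :: "nat list \<Rightarrow> 'a \<Rightarrow> nat"
    and F :: "nat \<Rightarrow> real \<Rightarrow> real"
  assumes "distribution_function G"
    and "a > 0" and "M\<^sub>0 > 0"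
    and "\<And>x M. x \<ge> 0 \<Longrightarrow> M \<ge> M\<^sub>0 \<Longrightarrow> 1 - G (x + M) \<le> exp (- a * M) * (1 - G x)"
    and "set_pmf p \<subseteq> {1..}" and "pmf p 1 < 1"
    and "1 < \<theta>" and "\<theta> \<le> 2" and "summable (\<lambda>k. real k powr \<theta> * pmf p k)"
    and "branching_random_walk \<Omega> G p X N"
    and "\<And>n. F n = cdf (distr \<Omega> borel (max_displacement X N n))"
  shows "tight (\<lambda>n. distr \<Omega> borel (\<lambda>\<omega>. max_displacement X N n \<omega> - median (F n)))"
proof -
  interpret branching_random_walk \<Omega> G p X N by fact
  define \<mu> where "\<mu> = distr \<Omega> borel (X [])"
  interpret \<mu>: real_distribution \<mu> unfolding \<mu>_def by (rule real_distribution_X)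
  have cdf_\<mu>: "cdf \<mu> = G" by (simp add: \<mu>_def X_distribution)
  have tail_\<mu>: "measure \<mu> {x<..} = 1 - G x" for x
    using \<mu>.prob_compl[of "{..x}"]
    by (simp add: cdf_\<mu>[symmetric] cdf_def Compl_eq_Diff_UNIV[symmetric])
  interpret brw_laws \<mu> p a M\<^sub>0 "\<theta> - 1"
  proof
    show "measure \<mu> {x + h<..} \<le> exp (- a * h) * measure \<mu> {x<..}" if "0 \<le> x" "M\<^sub>0 \<le> h" for x h
      using assms(4)[OF that] by (simp add: tail_\<mu>)
    show "integrable (measure_pmf p) (\<lambda>k. real k powr (1 + (\<theta> - 1)))"
      using assms(9) by (intro integrable_measure_pmf_if_summable) auto
  qed (use assms in auto)
  let ?M = "max_displacement X N"
  note [measurable] = max_displacement_measurable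
  have rd: "real_distribution (distr \<Omega> borel (?M n))" for n by simp
  have F: "F n x = 1 - u n x" for n x
  proof -
    have "F n x = prob {\<omega> \<in> space \<Omega>. ?M n \<omega> \<le> x}"
      unfolding assms(11) cdf_def
      by (subst measure_distr) (auto intro!: arg_cong[where f = prob])
    then show ?thesis
      using prob_max_displacement_le[OF assms(10,5) \<mu>.real_distribution_axioms cdf_\<mu>] by simp
  qed
  define med where "med n = median (F n)" for n
  have below: "F n x < 1 / 2" if "x < med n" for n x
    using real_distribution.less_median[OF rd] that by (simp add: med_def assms(11))
  have above: "1 / 2 \<le> F n x" if "med n < x" for n x
    using real_distribution.median_less[OF rd] that by (simp add: med_def assms(11))
  show ?thesis
    unfolding tight_def med_def[symmetric]
  proof (intro conjI allI impI)
    show "real_distribution (distr \<Omega> borel (\<lambda>\<omega>. ?M n \<omega> - med n))" for n by simp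
    fix \<epsilon> :: real assume \<epsilon>: "0 < \<epsilon>"
    \<comment> \<open>The first bound is to the right of the median, where the tail is at most \<open>1 / 2\<close>, the second to the left.\<close>
    obtain A where A: "\<And>n x y. u n x \<le> 1 - 1 / 2 \<Longrightarrow> \<epsilon> / 3 \<le> u n y \<Longrightarrow> y \<le> x + A"
      using bounded_width[of "1 / 2" "\<epsilon> / 3"] \<epsilon> by auto
    obtain A' where A': "\<And>n x y. u n x \<le> 1 - \<epsilon> / 3 \<Longrightarrow> 1 / 2 \<le> u n y \<Longrightarrow> y \<le> x + A'"
      using bounded_width[of "\<epsilon> / 3" "1 / 2"] \<epsilon> by auto
    define l where "l = min (- 1) (- 2 - A')"
    define r where "r = max 1 (2 + A)"
    have lr: "l < r" by (simp add: l_def r_def)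
    have "1 - \<epsilon> < measure (distr \<Omega> borel (\<lambda>\<omega>. ?M n \<omega> - med n)) {l<..r}" for n
    proof -
      have "measure (distr \<Omega> borel (\<lambda>\<omega>. ?M n \<omega> - med n)) {l<..r} =
          measure (distr \<Omega> borel (?M n)) {l + med n<..r + med n}"
        by (subst (1 2) measure_distr) (auto intro!: arg_cong[where f = prob])
      also have "\<dots> = F n (r + med n) - F n (l + med n)"
        using finite_borel_measure.cdf_diff_eq[OF real_distribution.finite_borel_measure_M[OF rd], of "l + med n" "r + med n" n] lr by (simp add: assms(11))
      finally have eq: "measure (distr \<Omega> borel (\<lambda>\<omega>. ?M n \<omega> - med n)) {l<..r} =
          u n (l + med n) - u n (r + med n)" by (simp add: F)
      have "u n (r + med n) < \<epsilon> / 3"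
      proof (rule ccontr)
        assume "\<not> ?thesis"
        then have "r + med n \<le> (med n + 1) + A"
          using above[of n "med n + 1"] by (intro A[of n]) (auto simp: F)
        then show False by (simp add: r_def)
      qed
      moreover have "1 - \<epsilon> / 3 < u n (l + med n)"
      proof (rule ccontr)
        assume "\<not> ?thesis"
        then have "med n - 1 \<le> (l + med n) + A'"
          using below[of "med n - 1" n] by (intro A'[of n]) (auto simp: F)
        then show False by (simp add: l_def min_def split: if_splits)
      qed
      ultimately show ?thesis using \<epsilon> unfolding eq by linarith
    qed
    with lr show "\<exists>a b. a < b \<and> (\<forall>n. 1 - \<epsilon> < measure (distr \<Omega> borel (\<lambda>\<omega>. ?M n \<omega> - med n)) {a<..b})"
      by blast
  qed
qed

end
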